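(* Let $\{S_j:j\in\mathscr J\}$ be a non-empty family of Hausdorff semitopological semigroups, each algebraically a primitive inverse semigroup, such that for each $j\in\mathscr J$ the space $S_j$ is either semiregular and pseudocompact or countably compact, and every maximal subgroup of $S_j$ (with the subspace topology) is a pseudocompact paratopological group. Then the direct product $\prod_{j\in\mathscr J}S_j$ with the Tychonoff product topology is a pseudocompact semitopological inverse semigroup.
   Context: A semitopological semigroup is a Hausdorff space with separately continuous associative operation; a paratopological group is a group with Hausdorff topology and jointly continuous multiplication. A semigroup is inverse if every $x$ has a unique $y$ with $xyx=x$, $yxy=y$; primitive inverse if it is non-trivial, inverse, has a zero and all non-zero idempotents are minimal among non-zero idempotents. Pseudocompact: every locally finite family of non-empty open sets is finite; semiregular: having a base of regular open sets. *)

theory Defs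
  imports "HOL-Analysis.Analysis"
begin

definition semigroup_on :: "'a set \<Rightarrow> ('a \<Rightarrow> 'a \<Rightarrow> 'a) \<Rightarrow> bool" where
  "semigroup_on S m \<longleftrightarrow>
     (\<forall>x\<in>S. \<forall>y\<in>S. m x y \<in> S) \<and>
     (\<forall>x\<in>S. \<forall>y\<in>S. \<forall>z\<in>S. m (m x y) z = m x (m y z))"

definition semitopological_semigroup :: "'a topology \<Rightarrow> ('a \<Rightarrow> 'a \<Rightarrow> 'a) \<Rightarrow> bool" where
  "semitopological_semigroup X m \<longleftrightarrow>
     Hausdorff_space X \<and> semigroup_on (topspace X) m \<and>
     (\<forall>a\<in>topspace X. continuous_map X X (\<lambda>x. m a x) \<and> continuous_map X X (\<lambda>x. m x a))"

definition inverse_semigroup :: "'a set \<Rightarrow> ('a \<Rightarrow> 'a \<Rightarrow> 'a) \<Rightarrow> bool" where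
  "inverse_semigroup S m \<longleftrightarrow> semigroup_on S m \<and>
     (\<forall>x\<in>S. \<exists>!y. y \<in> S \<and> m (m x y) x = x \<and> m (m y x) y = y)"

definition is_zero :: "'a set \<Rightarrow> ('a \<Rightarrow> 'a \<Rightarrow> 'a) \<Rightarrow> 'a \<Rightarrow> bool" where
  "is_zero S m z \<longleftrightarrow> z \<in> S \<and> (\<forall>x\<in>S. m z x = z \<and> m x z = z)"

definition idempotent_in :: "'a set \<Rightarrow> ('a \<Rightarrow> 'a \<Rightarrow> 'a) \<Rightarrow> 'a \<Rightarrow> bool" where
  "idempotent_in S m e \<longleftrightarrow> e \<in> S \<and> m e e = e"

definition primitive_inverse_semigroup :: "'a set \<Rightarrow> ('a \<Rightarrow> 'a \<Rightarrow> 'a) \<Rightarrow> bool" where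
  "primitive_inverse_semigroup S m \<longleftrightarrow>
     (\<exists>x\<in>S. \<exists>y\<in>S. x \<noteq> y) \<and> inverse_semigroup S m \<and>
     (\<exists>z. is_zero S m z \<and>
        (\<forall>e f. idempotent_in S m e \<and> idempotent_in S m f \<and> e \<noteq> z \<and> f \<noteq> z \<and>
               f = m e f \<and> f = m f e \<longrightarrow> f = e))"

definition pseudocompact_space :: "'a topology \<Rightarrow> bool" where
  "pseudocompact_space X \<longleftrightarrow>
     (\<forall>\<U>. (\<forall>U\<in>\<U>. openin X U \<and> U \<noteq> {}) \<and> locally_finite_in X \<U> \<longrightarrow> finite \<U>)"

definition countably_compact_space :: "'a topology \<Rightarrow> bool" where
  "countably_compact_space X \<longleftrightarrow>
     (\<forall>\<U>. countable \<U> \<and> (\<forall>U\<in>\<U>. openin X U) \<and> topspace X \<subseteq> \<Union>\<U> \<longrightarrow>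
        (\<exists>\<V>. \<V> \<subseteq> \<U> \<and> finite \<V> \<and> topspace X \<subseteq> \<Union>\<V>))"

definition regular_open_in :: "'a topology \<Rightarrow> 'a set \<Rightarrow> bool" where
  "regular_open_in X U \<longleftrightarrow> X interior_of (X closure_of U) = U"

definition semiregular_space :: "'a topology \<Rightarrow> bool" where
  "semiregular_space X \<longleftrightarrow>
     (\<forall>W x. openin X W \<and> x \<in> W \<longrightarrow> (\<exists>U. regular_open_in X U \<and> x \<in> U \<and> U \<subseteq> W))"

definition subgroup_of :: "'a set \<Rightarrow> ('a \<Rightarrow> 'a \<Rightarrow> 'a) \<Rightarrow> 'a set \<Rightarrow> bool" where
  "subgroup_of S m H \<longleftrightarrow> H \<subseteq> S \<and>
     (\<forall>x\<in>H. \<forall>y\<in>H. m x y \<in> H) \<and>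
     (\<exists>e\<in>H. (\<forall>x\<in>H. m e x = x \<and> m x e = x) \<and> (\<forall>x\<in>H. \<exists>y\<in>H. m x y = e \<and> m y x = e))"

definition maximal_subgroup :: "'a set \<Rightarrow> ('a \<Rightarrow> 'a \<Rightarrow> 'a) \<Rightarrow> 'a set \<Rightarrow> bool" where
  "maximal_subgroup S m H \<longleftrightarrow> subgroup_of S m H \<and>
     (\<forall>K. subgroup_of S m K \<and> H \<subseteq> K \<longrightarrow> K = H)"

definition paratopological_group :: "'a topology \<Rightarrow> ('a \<Rightarrow> 'a \<Rightarrow> 'a) \<Rightarrow> bool" where
  "paratopological_group X m \<longleftrightarrow>
     Hausdorff_space X \<and> semigroup_on (topspace X) m \<and>
     subgroup_of (topspace X) m (topspace X) \<and>
     continuous_map (prod_topology X X) X (\<lambda>(x, y). m x y)"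

text \<open>Pointwise multiplication on the direct product (elements are extensional
  functions on the index set J, as in product_topology).\<close>

definition prod_mult :: "'j set \<Rightarrow> ('j \<Rightarrow> 'a \<Rightarrow> 'a \<Rightarrow> 'a) \<Rightarrow> ('j \<Rightarrow> 'a) \<Rightarrow> ('j \<Rightarrow> 'a) \<Rightarrow> ('j \<Rightarrow> 'a)" where
  "prod_mult J m f g = (\<lambda>j\<in>J. m j (f j) (g j))"

end

theory Submission
  imports Defs "HOL-Algebra.Group" "HOL-Library.Diagonal_Subsequence"
begin

text \<open>
  Pseudocompactness is not productive, but the following sequential strengthening is, by a diagonal
  argument: every sequence of non-empty open sets has a subsequence that converges to a point, in
  the sense that each neighbourhood of the point meets almost all of its members.

  A pseudocompact paratopological group has this property. Given \<open>x\<^sub>k \<in> U\<^sub>k\<close>, choose unit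
  neighbourhoods \<open>V\<^sub>k\<close> with \<open>x\<^sub>k V\<^sub>k \<subseteq> U\<^sub>k\<close> and
  \<open>(V\<^sub>k\<^sub>+\<^sub>1 V\<^sub>k\<^sub>+\<^sub>1\<^sup>-\<^sup>1)\<^sup>2 \<subseteq> cl V\<^sub>k\<close>. Fix a subsequence along which \<open>x\<^sub>k V\<^sub>k\<close> meets smaller and smaller
  neighbourhoods \<open>y V\<^sub>n\<close> of a cluster point \<open>y\<close>. All its further cluster points lie in \<open>y N\<close> with
  \<open>N = \<Inter> cl V\<^sub>k\<close>, and \<open>x\<^sub>k N\<close> is contained in the interior of \<open>cl U\<^sub>k\<close>; so right translation by an
  element of \<open>N\<close> shows that \<open>y\<close> itself is a limit of the \<open>U\<^sub>k\<close>. This replaces the compact completion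
  in the classical proof of the Comfort-Ross theorem.

  In a primitive inverse semigroup, the non-zero elements are partitioned into the open sets
  \<open>H\<^sub>e\<^sub>,\<^sub>f = {x. exf \<noteq> 0}\<close>, each a translate of a maximal subgroup. A sequence of open sets either
  meets one of them infinitely often or, by pseudocompactness, converges to zero.
\<close>

no_notation eq_closure_of ("closure'_of\<index>")

section \<open>Sequential feeble compactness\<close>

definition set_limit :: "'a topology \<Rightarrow> (nat \<Rightarrow> 'a set) \<Rightarrow> 'a \<Rightarrow> bool" where
  "set_limit X U x \<longleftrightarrow> x \<in> topspace X \<and>
     (\<forall>W. openin X W \<and> x \<in> W \<longrightarrow> (\<forall>\<^sub>F n in sequentially. W \<inter> U n \<noteq> {}))"

definition sequentially_feebly_compact :: "'a topology \<Rightarrow> bool" where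
  "sequentially_feebly_compact X \<longleftrightarrow>
     (\<forall>U :: nat \<Rightarrow> 'a set. (\<forall>n. openin X (U n) \<and> U n \<noteq> {}) \<longrightarrow> (\<exists>x r. strict_mono r \<and> set_limit X (U \<circ> r) x))"

lemma set_limit_subseq:
  fixes U :: "nat \<Rightarrow> 'a set"
  assumes "strict_mono r" "set_limit X U x"
  shows "set_limit X (U \<circ> r) x"
  using assms eventually_subseq[OF assms(1)] unfolding set_limit_def by auto

lemma sequentially_feebly_compactE:
  fixes U :: "nat \<Rightarrow> 'a set"
  assumes "sequentially_feebly_compact X" "\<And>n. openin X (U n)" "\<And>n. U n \<noteq> {}"
  obtains x r where "strict_mono r" "set_limit X (U \<circ> r) x"
  using assms unfolding sequentially_feebly_compact_def by meson

lemma sequentially_feebly_compactI: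
  assumes "\<And>U :: nat \<Rightarrow> 'a set. (\<And>n. openin X (U n)) \<Longrightarrow> (\<And>n. U n \<noteq> {}) \<Longrightarrow> \<exists>x r. strict_mono r \<and> set_limit X (U \<circ> r) x"
  shows "sequentially_feebly_compact X"
  using assms unfolding sequentially_feebly_compact_def by auto

text \<open>Since each index set is infinite, \<open>r (Suc n)\<close> can be picked beyond
  \<open>r n\<close>. The condition may change with \<open>n\<close>, which later allows smaller and
  smaller neighbourhoods of a point.\<close>

lemma infinite_strict_mono_choice:
  fixes P :: "nat \<Rightarrow> nat \<Rightarrow> bool"
  assumes "\<And>n. infinite {k. P n k}"
  obtains r where "strict_mono r" "\<And>n. P n (r n)"
proof -
  have ex: "\<exists>k>l. P n k" for n l
    using assms[of n] unfolding infinite_nat_iff_unbounded by auto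
  obtain k0 where "P 0 k0" using ex by blast
  then have "\<exists>r. \<forall>n. P n (r n) \<and> r n < r (Suc n)"
    using ex by (intro dependent_nat_choice) auto
  then show thesis using that by (metis strict_mono_Suc_iff)
qed

text \<open>Local finiteness concerns sets of sets, while a sequence may repeat its members. If its
  range is finite, one member recurs infinitely often and any of its points clusters; otherwise the
  range is infinite and fails to be locally finite at some point. The index set \<open>I\<close>
  allows application to the indices where a desired convergence fails.\<close>

lemma pseudocompact_space_cluster_point:
  fixes U :: "nat \<Rightarrow> 'a set"
  assumes X: "pseudocompact_space X" and I: "infinite I"
    and U: "\<And>n. n \<in> I \<Longrightarrow> openin X (U n) \<and> U n \<noteq> {}"
  obtains x where "x \<in> topspace X"
    "\<And>W. openin X W \<Longrightarrow> x \<in> W \<Longrightarrow> infinite {n\<in>I. W \<inter> U n \<noteq> {}}"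
proof (cases "finite (U ` I)")
  case True
  then obtain k where k: "k \<in> I" "infinite {n\<in>I. U n = U k}"
    using pigeonhole_infinite[OF I] by auto
  obtain x where x: "x \<in> U k" using U k(1) by blast
  show thesis
  proof
    show "x \<in> topspace X" using x U[OF k(1)] openin_subset by blast
    show "infinite {n\<in>I. W \<inter> U n \<noteq> {}}" if "x \<in> W" for W
      by (rule infinite_super[OF _ k(2)]) (use x that in auto)
  qed
next
  case False
  then have "\<not> locally_finite_in X (U ` I)"
    using X U unfolding pseudocompact_space_def by blast
  moreover have "\<Union> (U ` I) \<subseteq> topspace X" using U openin_subset by blast
  ultimately obtain x where x: "x \<in> topspace X"
      "\<And>V. openin X V \<Longrightarrow> x \<in> V \<Longrightarrow> infinite {A \<in> U ` I. A \<inter> V \<noteq> {}}"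
    unfolding locally_finite_in_def by blast
  show thesis
  proof
    show "x \<in> topspace X" by fact
    fix W assume W: "openin X W" "x \<in> W"
    have "{A \<in> U ` I. A \<inter> W \<noteq> {}} = U ` {n\<in>I. W \<inter> U n \<noteq> {}}" by auto
    then have "infinite (U ` {n\<in>I. W \<inter> U n \<noteq> {}})" using x(2)[OF W] by simp
    then show "infinite {n\<in>I. W \<inter> U n \<noteq> {}}" by (rule contrapos_nn) (rule finite_imageI)
  qed
qed

section \<open>Comparison with pseudocompactness and countable compactness\<close>

text \<open>An infinite family contains a sequence of distinct members, and every neighbourhood of a
  limit of a subsequence meets infinitely many of them.\<close>

lemma sequentially_feebly_compact_imp_pseudocompact:
  assumes "sequentially_feebly_compact X"
  shows "pseudocompact_space X"
  unfolding pseudocompact_space_def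
proof (intro allI impI)
  fix \<U> assume \<U>: "(\<forall>U\<in>\<U>. openin X U \<and> U \<noteq> {}) \<and> locally_finite_in X \<U>"
  show "finite \<U>"
  proof (rule ccontr)
    assume "infinite \<U>"
    then obtain U :: "nat \<Rightarrow> 'a set" where U: "inj U" "range U \<subseteq> \<U>"
      using infinite_countable_subset by blast
    have "openin X (U n)" "U n \<noteq> {}" for n using \<U> U(2) by auto
    then obtain x r where r: "strict_mono r" and lim: "set_limit X (U \<circ> r) x"
      using sequentially_feebly_compactE[OF assms] by metis
    have x: "x \<in> topspace X" using lim unfolding set_limit_def by blast
    obtain W where W: "openin X W" "x \<in> W" "finite {A \<in> \<U>. A \<inter> W \<noteq> {}}"
      using \<U> x unfolding locally_finite_in_def by blast
    have "\<forall>\<^sub>F n in sequentially. W \<inter> U (r n) \<noteq> {}"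
      using lim W(1,2) unfolding set_limit_def by auto
    then obtain N where N: "\<And>n. n \<ge> N \<Longrightarrow> W \<inter> U (r n) \<noteq> {}"
      unfolding eventually_sequentially by blast
    have "(\<lambda>n. U (r n)) ` {N..} \<subseteq> {A \<in> \<U>. A \<inter> W \<noteq> {}}" using N U(2) by blast
    moreover have "inj (\<lambda>n. U (r n))"
      using inj_compose[OF U(1) strict_mono_imp_inj_on[OF r]] by (simp add: comp_def)
    then have "infinite ((\<lambda>n. U (r n)) ` {N..})"
      using finite_imageD inj_on_subset infinite_Ici by blast
    ultimately show False using W(3) finite_subset by blast
  qed
qed

text \<open>For distinct members \<open>U n\<close> of a locally finite family, the complements
  \<open>C n\<close> of the closures of the tails form an increasing open cover. A finite subcover
  would make a single \<open>C n\<close> the whole space, although it misses the non-empty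
  \<open>U n\<close>.\<close>

lemma countably_compact_imp_pseudocompact:
  assumes cc: "countably_compact_space X"
  shows "pseudocompact_space X"
  unfolding pseudocompact_space_def
proof (intro allI impI)
  fix \<U> assume \<U>: "(\<forall>U\<in>\<U>. openin X U \<and> U \<noteq> {}) \<and> locally_finite_in X \<U>"
  show "finite \<U>"
  proof (rule ccontr)
    assume "infinite \<U>"
    then obtain U :: "nat \<Rightarrow> 'a set" where U: "inj U" "range U \<subseteq> \<U>"
      using infinite_countable_subset by blast
    define C where "C n = topspace X - X closure_of (\<Union>k\<in>{n..}. U k)" for n
    have C_mono: "C n \<subseteq> C k" if "n \<le> k" for n k
      unfolding C_def using that by (intro Diff_mono closure_of_mono UN_mono) auto
    have "x \<in> \<Union> (range C)" if x: "x \<in> topspace X" for x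
    proof -
      obtain W where W: "openin X W" "x \<in> W" "finite {A \<in> \<U>. A \<inter> W \<noteq> {}}"
        using \<U> x unfolding locally_finite_in_def by blast
      have "U ` {k. U k \<inter> W \<noteq> {}} \<subseteq> {A \<in> \<U>. A \<inter> W \<noteq> {}}" using U(2) by blast
      then have "finite (U ` {k. U k \<inter> W \<noteq> {}})" using W(3) by (rule finite_subset)
      then have "finite {k. U k \<inter> W \<noteq> {}}"
        by (rule finite_imageD) (rule inj_on_subset[OF U(1) subset_UNIV])
      then obtain n where "\<And>k. U k \<inter> W \<noteq> {} \<Longrightarrow> k < n"
        using finite_nat_bounded[of "{k. U k \<inter> W \<noteq> {}}"] by auto
      then have "W \<inter> (\<Union>k\<in>{n..}. U k) = {}" by force
      then have "x \<in> C n" using x W by (auto simp: C_def in_closure_of)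
      then show ?thesis by blast
    qed
    moreover have "openin X (C n)" for n
      unfolding C_def by (simp add: openin_diff)
    ultimately have "countable (range C) \<and> (\<forall>U\<in>range C. openin X U) \<and> topspace X \<subseteq> \<Union> (range C)"
      by auto
    then obtain \<V> where \<V>: "\<V> \<subseteq> range C" "finite \<V>" "topspace X \<subseteq> \<Union>\<V>"
      using cc unfolding countably_compact_space_def by meson
    then obtain F where F: "finite F" "\<V> = C ` F" using finite_subset_image by metis
    then obtain n where n: "F \<subseteq> {..n}" using finite_nat_iff_bounded_le by auto
    have "C k \<subseteq> C n" if "k \<in> F" for k using n that by (intro C_mono) auto
    then have "topspace X \<subseteq> C n" using \<V>(3) unfolding F(2) by blast
    moreover have "openin X (U n)" "U n \<noteq> {}" using \<U> U(2) by blast+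
    then obtain u where "u \<in> U n" "u \<in> topspace X" using openin_subset by blast
    then have "u \<in> X closure_of (\<Union>k\<in>{n..}. U k)"
      by (auto simp: in_closure_of)
    ultimately show False using \<open>u \<in> topspace X\<close> unfolding C_def by blast
  qed
qed

section \<open>Images, open covers and products\<close>

lemma sequentially_feebly_compact_continuous_map_image:
  assumes X: "sequentially_feebly_compact X" and f: "continuous_map X Y f"
    and surj: "f ` topspace X = topspace Y"
  shows "sequentially_feebly_compact Y"
proof (rule sequentially_feebly_compactI)
  fix U :: "nat \<Rightarrow> 'b set" assume U: "\<And>n. openin Y (U n)" "\<And>n. U n \<noteq> {}"
  define P where "P A = {x \<in> topspace X. f x \<in> A}" for A
  have P: "openin X (P A)" if "openin Y A" for A
    unfolding P_def using f that by (simp add: openin_continuous_map_preimage)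
  have PU: "openin X (P (U n))" for n using P U(1) by blast
  have P_ne: "P (U n) \<noteq> {}" for n
  proof -
    obtain y where "y \<in> U n" "y \<in> topspace Y" using U[of n] openin_subset by blast
    then obtain x where "x \<in> topspace X" "f x \<in> U n" using surj by (metis imageE)
    then show ?thesis unfolding P_def by blast
  qed
  obtain x r where r: "strict_mono r" and lim: "set_limit X ((\<lambda>n. P (U n)) \<circ> r) x"
    by (rule sequentially_feebly_compactE[OF X, of "\<lambda>n. P (U n)", OF PU P_ne])
  have x: "x \<in> topspace X" using lim unfolding set_limit_def by blast
  have "\<forall>\<^sub>F n in sequentially. W \<inter> U (r n) \<noteq> {}" if W: "openin Y W" "f x \<in> W" for W
  proof -
    have "x \<in> P W" using W x unfolding P_def by simp
    then have "\<forall>\<^sub>F n in sequentially. P W \<inter> P (U (r n)) \<noteq> {}"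
      using lim P[OF W(1)] unfolding set_limit_def comp_def by blast
    then show ?thesis by eventually_elim (auto simp: P_def)
  qed
  moreover have "f x \<in> topspace Y" using x surj by blast
  ultimately show "\<exists>x r. strict_mono r \<and> set_limit Y (U \<circ> r) x"
    using r unfolding set_limit_def comp_def by blast
qed

text \<open>Either some member of the cover meets infinitely many \<open>U n\<close> and supplies a
  limit, or no point other than \<open>z\<close> can be a cluster point of a subsequence. In the
  latter case pseudocompactness makes the whole sequence converge to \<open>z\<close>.\<close>

lemma sequentially_feebly_compact_point_open_cover:
  assumes X: "pseudocompact_space X" and z: "z \<in> topspace X"
    and cover: "topspace X - {z} \<subseteq> \<Union>\<C>"
    and open_C: "\<And>C. C \<in> \<C> \<Longrightarrow> openin X C"
    and C: "\<And>C. C \<in> \<C> \<Longrightarrow> sequentially_feebly_compact (subtopology X C)"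
  shows "sequentially_feebly_compact X"
proof (rule sequentially_feebly_compactI)
  fix U :: "nat \<Rightarrow> 'a set" assume U: "\<And>n. openin X (U n)" "\<And>n. U n \<noteq> {}"
  consider (inf_C) C where "C \<in> \<C>" "infinite {n. U n \<inter> C \<noteq> {}}"
    | (fin_C) "\<And>C. C \<in> \<C> \<Longrightarrow> finite {n. U n \<inter> C \<noteq> {}}"
    by blast
  then show "\<exists>x r. strict_mono r \<and> set_limit X (U \<circ> r) x"
  proof cases
    case inf_C
    obtain s :: "nat \<Rightarrow> nat" where s: "strict_mono s" "\<And>n. U (s n) \<inter> C \<noteq> {}"
      using infinite_strict_mono_choice[of "\<lambda>_ k. U k \<inter> C \<noteq> {}"] inf_C(2) by blast
    have "openin (subtopology X C) (U (s n) \<inter> C)" for n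
      using U(1) by (rule openin_subtopology_Int)
    then obtain x r where r: "strict_mono r"
      and lim: "set_limit (subtopology X C) ((\<lambda>n. U (s n) \<inter> C) \<circ> r) x"
      using sequentially_feebly_compactE[OF C[OF inf_C(1)], of "\<lambda>n. U (s n) \<inter> C"] s(2) by metis
    have x: "x \<in> C" "x \<in> topspace X" using lim unfolding set_limit_def by auto
    have "\<forall>\<^sub>F n in sequentially. W \<inter> U (s (r n)) \<noteq> {}" if W: "openin X W" "x \<in> W" for W
    proof -
      have "openin (subtopology X C) (W \<inter> C)" using W(1) by (rule openin_subtopology_Int)
      then have "\<forall>\<^sub>F n in sequentially. (W \<inter> C) \<inter> (U (s (r n)) \<inter> C) \<noteq> {}"
        using lim W(2) x(1) unfolding set_limit_def by auto
      then show ?thesis by eventually_elim auto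
    qed
    then have "set_limit X (U \<circ> (s \<circ> r)) x" using x(2) unfolding set_limit_def by auto
    then show ?thesis using strict_mono_o[OF s(1) r] by blast
  next
    case fin_C
    have "\<forall>\<^sub>F n in sequentially. W \<inter> U n \<noteq> {}" if W: "openin X W" "z \<in> W" for W
    proof (rule ccontr)
      \<comment> \<open>If \<open>W\<close> misses infinitely many \<open>U n\<close>, these have a
        cluster point: it cannot be \<open>z\<close> because of \<open>W\<close>, nor lie in any
        \<open>C\<close> because each \<open>C\<close> meets only finitely many
        \<open>U n\<close>.\<close>
      define I where "I = {n. W \<inter> U n = {}}"
      assume "\<not> ?thesis"
      then have I: "infinite I"
        unfolding I_def by (simp add: frequently_cofinite cofinite_eq_sequentially[symmetric]
            eventually_cofinite)
      obtain x where x: "x \<in> topspace X"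
        "\<And>V. openin X V \<Longrightarrow> x \<in> V \<Longrightarrow> infinite {n \<in> I. V \<inter> U n \<noteq> {}}"
        by (rule pseudocompact_space_cluster_point[OF X I, of U]) (use U in auto)
      show False
      proof (cases "x = z")
        case True
        then have "infinite {n \<in> I. W \<inter> U n \<noteq> {}}" using x(2) W by blast
        then show False by (simp add: I_def)
      next
        case False
        then obtain C where C: "C \<in> \<C>" "x \<in> C" using cover x(1) by blast
        then have "infinite {n \<in> I. C \<inter> U n \<noteq> {}}" using x(2) open_C by blast
        moreover have "{n \<in> I. C \<inter> U n \<noteq> {}} \<subseteq> {n. U n \<inter> C \<noteq> {}}" by auto
        ultimately show False using fin_C[OF C(1)] finite_subset by blast
      qed
    qed
    then have "set_limit X (U \<circ> id) z" using z unfolding set_limit_def by auto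
    moreover have "strict_mono (id :: nat \<Rightarrow> nat)" by (simp add: strict_mono_def)
    ultimately show ?thesis by blast
  qed
qed

text \<open>After each \<open>U n\<close> is shrunk to a basic box, only countably many coordinates
  are ever restricted. A diagonal subsequence converges in all of these, and in any other coordinate
  every point is a limit.\<close>

lemma sequentially_feebly_compact_product:
  assumes X: "\<And>j. j \<in> J \<Longrightarrow> sequentially_feebly_compact (X j)"
  shows "sequentially_feebly_compact (product_topology X J)"
proof (rule sequentially_feebly_compactI)
  fix U :: "nat \<Rightarrow> ('a \<Rightarrow> 'b) set" assume U: "\<And>n. openin (product_topology X J) (U n)" "\<And>n. U n \<noteq> {}"
  have "\<forall>n. \<exists>B. finite {j\<in>J. B j \<noteq> topspace (X j)} \<and> (\<forall>j\<in>J. openin (X j) (B j)) \<and>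
          Pi\<^sub>E J B \<noteq> {} \<and> Pi\<^sub>E J B \<subseteq> U n"
  proof
    fix n
    obtain u where u: "u \<in> U n" using U by blast
    with U(1)[of n] obtain B where "finite {j\<in>J. B j \<noteq> topspace (X j)}" "\<forall>j\<in>J. openin (X j) (B j)"
        "u \<in> Pi\<^sub>E J B" "Pi\<^sub>E J B \<subseteq> U n"
      unfolding openin_product_topology_alt by meson
    then show "\<exists>B. finite {j\<in>J. B j \<noteq> topspace (X j)} \<and> (\<forall>j\<in>J. openin (X j) (B j)) \<and>
        Pi\<^sub>E J B \<noteq> {} \<and> Pi\<^sub>E J B \<subseteq> U n" by blast
  qed
  from choice[OF this] obtain B where B': "\<forall>n. finite {j\<in>J. B n j \<noteq> topspace (X j)} \<and>
      (\<forall>j\<in>J. openin (X j) (B n j)) \<and> Pi\<^sub>E J (B n) \<noteq> {} \<and> Pi\<^sub>E J (B n) \<subseteq> U n" ..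
  then have B: "\<And>n. finite {j\<in>J. B n j \<noteq> topspace (X j)}"
      "\<And>n j. j \<in> J \<Longrightarrow> openin (X j) (B n j)" "\<And>n. Pi\<^sub>E J (B n) \<noteq> {}" "\<And>n. Pi\<^sub>E J (B n) \<subseteq> U n"
    by auto
  have B_ne: "B n j \<noteq> {}" if "j \<in> J" for n j
  proof -
    obtain u where "u \<in> Pi\<^sub>E J (B n)" using B(3)[of n] by blast
    then show ?thesis using that by (auto simp: PiE_iff)
  qed
  define C where "C = (\<Union>n. {j\<in>J. B n j \<noteq> topspace (X j)})"
  have "countable C" unfolding C_def by (rule countable_UN) (auto intro!: countable_finite B(1))
  then obtain f :: "nat \<Rightarrow> 'a" where f: "C \<subseteq> range f"
    using subset_range_from_nat_into by blast
  define conv where "conv j s x \<longleftrightarrow> set_limit (X j) ((\<lambda>n. B n j) \<circ> s) x" for j s x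
  have conv_subseq: "conv j (s \<circ> r) x" if "strict_mono r" "conv j s x" for j s r x
    using set_limit_subseq[OF that(1) that(2)[unfolded conv_def]] unfolding conv_def comp_assoc .
  \<comment> \<open>The guard \<open>f i \<in> J\<close> is there because \<open>f\<close> is only
    known to cover \<open>C\<close>; its remaining values may lie outside \<open>J\<close>.\<close>
  interpret subseqs "\<lambda>i s. f i \<in> J \<longrightarrow> (\<exists>x. conv (f i) s x)"
  proof
    fix i and s :: "nat \<Rightarrow> nat"
    show "\<exists>r. strict_mono r \<and> (f i \<in> J \<longrightarrow> (\<exists>x. conv (f i) (s \<circ> r) x))"
    proof (cases "f i \<in> J")
      case True
      obtain x r where "strict_mono r" "set_limit (X (f i)) ((\<lambda>n. B (s n) (f i)) \<circ> r) x"
        using sequentially_feebly_compactE[OF X[OF True] B(2)[OF True] B_ne[OF True], of s] by blast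
      then show ?thesis unfolding conv_def comp_def by blast
    qed (auto intro: strict_monoI)
  qed
  have ex_conv: "\<exists>x. conv j diagseq x" if j: "j \<in> J" for j
  proof (cases "j \<in> C")
    case True
    then obtain i where i: "j = f i" using f by blast
    \<comment> \<open>The diagonal sequence is a subsequence of the \<open>i\<close>-th one only
      from index \<open>Suc i\<close> on; the shift is removed below, as convergence depends on
      tails only.\<close>
    have "f i \<in> J \<longrightarrow> (\<exists>x. conv (f i) (diagseq \<circ> ((+) (Suc i))) x)"
      by (rule diagseq_holds) (use conv_subseq in blast)
    then obtain x where x: "conv j (diagseq \<circ> ((+) (Suc i))) x" using j i by blast
    have "\<forall>\<^sub>F n in sequentially. W \<inter> B (diagseq n) j \<noteq> {}" if "openin (X j) W" "x \<in> W" for W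
    proof -
      have "\<forall>\<^sub>F n in sequentially. W \<inter> B (diagseq (n + Suc i)) j \<noteq> {}"
        using x that unfolding conv_def set_limit_def by (simp add: add.commute)
      then show ?thesis by (rule eventually_sequentially_seg[THEN iffD1])
    qed
    then show ?thesis using x unfolding conv_def set_limit_def by auto
  next
    case False
    then have "B n j = topspace (X j)" for n using j unfolding C_def by blast
    moreover obtain x where "x \<in> topspace (X j)" using B_ne[OF j] B(2)[OF j] openin_subset by blast
    ultimately have "conv j diagseq x"
      unfolding conv_def set_limit_def using openin_subset by force
    then show ?thesis ..
  qed
  define z where "z j = (SOME x. conv j diagseq x)" for j
  have z: "conv j diagseq (z j)" if "j \<in> J" for j
    unfolding z_def using ex_conv[OF that] by (rule someI_ex)
  define x where "x = restrict z J"
  have "\<forall>\<^sub>F n in sequentially. W \<inter> U (diagseq n) \<noteq> {}"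
    if W: "openin (product_topology X J) W" "x \<in> W" for W
  proof -
    obtain V where V: "finite {j\<in>J. V j \<noteq> topspace (X j)}" "\<forall>j\<in>J. openin (X j) (V j)"
        "x \<in> Pi\<^sub>E J V" "Pi\<^sub>E J V \<subseteq> W"
      using W unfolding openin_product_topology_alt by meson
    have "\<forall>\<^sub>F n in sequentially. \<forall>j\<in>{j\<in>J. V j \<noteq> topspace (X j)}. V j \<inter> B (diagseq n) j \<noteq> {}"
    proof (rule eventually_ball_finite[OF V(1)], rule ballI)
      fix j assume "j \<in> {j\<in>J. V j \<noteq> topspace (X j)}"
      then have j: "j \<in> J" by simp
      then have "z j \<in> V j" using V(3) unfolding x_def by (auto simp: PiE_iff)
      then show "\<forall>\<^sub>F n in sequentially. V j \<inter> B (diagseq n) j \<noteq> {}"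
        using z[OF j] V(2) j unfolding conv_def set_limit_def by auto
    qed
    then show ?thesis
    proof eventually_elim
      case (elim n)
      \<comment> \<open>Only the finitely many coordinates restricted by \<open>V\<close> impose a
        condition; elsewhere non-emptiness of \<open>B (diagseq n) j\<close> is enough.\<close>
      have "V j \<inter> B (diagseq n) j \<noteq> {}" if j: "j \<in> J" for j
      proof (cases "V j = topspace (X j)")
        case True
        then show ?thesis using B_ne[OF j] B(2)[OF j] openin_subset by blast
      qed (use elim j in blast)
      then have "\<forall>j\<in>J. \<exists>w. w \<in> V j \<inter> B (diagseq n) j" by blast
      then obtain w where w: "\<forall>j\<in>J. w j \<in> V j \<inter> B (diagseq n) j" by (rule bchoice[THEN exE])
      then have "restrict w J \<in> Pi\<^sub>E J V \<inter> Pi\<^sub>E J (B (diagseq n))" by auto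
      then show ?case using V(4) B(4)[of "diagseq n"] by blast
    qed
  qed
  moreover have "x \<in> topspace (product_topology X J)"
    using z unfolding x_def conv_def set_limit_def by (simp add: PiE_iff)
  ultimately have "set_limit (product_topology X J) (U \<circ> diagseq) x"
    unfolding set_limit_def comp_def by blast
  then show "\<exists>x r. strict_mono r \<and> set_limit (product_topology X J) (U \<circ> r) x"
    using subseq_diagseq by blast
qed

section \<open>Pseudocompact paratopological groups\<close>

text \<open>Inversion is purely algebraic here. Continuity is assumed for multiplication alone, so
  inverses of neighbourhoods have to be controlled separately.\<close>

locale paratopological_group_structure = group G for G (structure) +
  fixes T :: "'a topology"
  assumes topspace_eq: "topspace T = carrier G"
    and continuous_mult: "continuous_map (prod_topology T T) T (\<lambda>(x, y). x \<otimes> y)"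
begin

lemma open_carrier: "openin T U \<Longrightarrow> x \<in> U \<Longrightarrow> x \<in> carrier G"
  using openin_subset topspace_eq by blast

lemma closure_carrier: "x \<in> T closure_of U \<Longrightarrow> x \<in> carrier G"
  using closure_of_subset_topspace[of T U] topspace_eq by blast

lemma inv_mult_cancel [simp]:
  assumes "x \<in> carrier G" "y \<in> carrier G"
  shows "inv x \<otimes> (x \<otimes> y) = y" "x \<otimes> (inv x \<otimes> y) = y"
  using assms by (metis m_assoc l_inv l_one inv_closed, metis m_assoc r_inv l_one inv_closed)

lemma continuous_mult_left: "a \<in> carrier G \<Longrightarrow> continuous_map T T (\<lambda>x. a \<otimes> x)"
  using continuous_map_compose[OF _ continuous_mult, of T "\<lambda>x. (a, x)"]
  by (simp add: comp_def continuous_map_pairedI topspace_eq)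

lemma continuous_mult_right: "a \<in> carrier G \<Longrightarrow> continuous_map T T (\<lambda>x. x \<otimes> a)"
  using continuous_map_compose[OF _ continuous_mult, of T "\<lambda>x. (x, a)"]
  by (simp add: comp_def continuous_map_pairedI topspace_eq)

lemma openin_mult_left_vimage:
  "a \<in> carrier G \<Longrightarrow> openin T U \<Longrightarrow> openin T {x \<in> carrier G. a \<otimes> x \<in> U}"
  using openin_continuous_map_preimage[OF continuous_mult_left] by (simp add: topspace_eq)

lemma openin_mult_right_vimage:
  "a \<in> carrier G \<Longrightarrow> openin T U \<Longrightarrow> openin T {x \<in> carrier G. x \<otimes> a \<in> U}"
  using openin_continuous_map_preimage[OF continuous_mult_right] by (simp add: topspace_eq)

lemma open_mult_nbhds:
  assumes U: "openin T U" and xy: "x \<in> carrier G" "y \<in> carrier G" "x \<otimes> y \<in> U"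
  obtains V W where "openin T V" "x \<in> V" "openin T W" "y \<in> W"
    "\<And>v w. v \<in> V \<Longrightarrow> w \<in> W \<Longrightarrow> v \<otimes> w \<in> U"
proof -
  have "openin (prod_topology T T) {p \<in> topspace (prod_topology T T). (\<lambda>(x, y). x \<otimes> y) p \<in> U}"
    using continuous_mult U by (rule openin_continuous_map_preimage)
  moreover have "(x, y) \<in> {p \<in> topspace (prod_topology T T). (\<lambda>(x, y). x \<otimes> y) p \<in> U}"
    using xy by (simp add: topspace_eq)
  ultimately obtain V W where VW: "openin T V" "x \<in> V" "openin T W" "y \<in> W"
    "V \<times> W \<subseteq> {p \<in> topspace (prod_topology T T). (\<lambda>(x, y). x \<otimes> y) p \<in> U}"
    unfolding openin_prod_topology_alt by meson
  show thesis
  proof (rule that[OF VW(1-4)])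
    fix v w assume "v \<in> V" "w \<in> W"
    with VW(5) have "(v, w) \<in> {p \<in> topspace (prod_topology T T). (\<lambda>(x, y). x \<otimes> y) p \<in> U}"
      by (meson SigmaI subsetD)
    then show "v \<otimes> w \<in> U" by simp
  qed
qed

text \<open>By joint continuity a neighbourhood of \<open>x \<otimes> y\<close> contains a product
  of neighbourhoods of \<open>x\<close> and \<open>y\<close>, which meet \<open>A\<close> and
  \<open>B\<close>. This carries inclusions between products over to closures.\<close>

lemma closure_mult:
  assumes x: "x \<in> T closure_of A" and y: "y \<in> T closure_of B"
    and AB: "\<And>a b. a \<in> A \<Longrightarrow> b \<in> B \<Longrightarrow> a \<otimes> b \<in> C"
  shows "x \<otimes> y \<in> T closure_of C"
proof -
  have xy: "x \<in> carrier G" "y \<in> carrier G" using x y closure_carrier by auto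
  have "\<exists>c. c \<in> C \<and> c \<in> U" if U: "x \<otimes> y \<in> U" "openin T U" for U
  proof -
    obtain V W where VW: "openin T V" "x \<in> V" "openin T W" "y \<in> W"
      "\<And>v w. v \<in> V \<Longrightarrow> w \<in> W \<Longrightarrow> v \<otimes> w \<in> U"
      using open_mult_nbhds[OF U(2) xy U(1)] by metis
    obtain a b where "a \<in> A" "a \<in> V" "b \<in> B" "b \<in> W"
      using x y VW unfolding in_closure_of by meson
    then show ?thesis using AB VW(5) by blast
  qed
  then show ?thesis using xy by (auto simp: in_closure_of topspace_eq)
qed

lemma closure_mult_left:
  assumes "a \<in> carrier G" "y \<in> T closure_of B" "\<And>b. b \<in> B \<Longrightarrow> a \<otimes> b \<in> C"
  shows "a \<otimes> y \<in> T closure_of C"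
  by (rule closure_mult[of a "{a}" y B]) (use assms in \<open>auto simp: in_closure_of topspace_eq\<close>)

lemma closure_mult_right:
  assumes "a \<in> carrier G" "y \<in> T closure_of B" "\<And>b. b \<in> B \<Longrightarrow> b \<otimes> a \<in> C"
  shows "y \<otimes> a \<in> T closure_of C"
  by (rule closure_mult[of y B a "{a}"]) (use assms in \<open>auto simp: in_closure_of topspace_eq\<close>)

lemma unit_nbhd_square:
  assumes "openin T U" "\<one> \<in> U"
  obtains V where "openin T V" "\<one> \<in> V" "\<And>v w. v \<in> V \<Longrightarrow> w \<in> V \<Longrightarrow> v \<otimes> w \<in> U"
proof -
  have "\<one> \<otimes> \<one> \<in> U" using assms by simp
  from open_mult_nbhds[OF assms(1) one_closed one_closed this]
  obtain V W where VW: "openin T V" "\<one> \<in> V" "openin T W" "\<one> \<in> W"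
    "\<And>v w. v \<in> V \<Longrightarrow> w \<in> W \<Longrightarrow> v \<otimes> w \<in> U" by metis
  show thesis by (rule that[of "V \<inter> W"]) (use VW in auto)
qed

end

locale pseudocompact_paratopological_group = paratopological_group_structure +
  assumes pseudocompact: "pseudocompact_space T"
begin

text \<open>
  If \<open>inv x\<^sub>n\<close> stays outside \<open>cl U\<close> for \<open>x\<^sub>n \<in> V\<^sub>n\<close>, the products \<open>y\<^sub>n = x\<^sub>1 \<cdots> x\<^sub>n\<close> move forward only: a
  cluster point \<open>z\<close> of small neighbourhoods of the \<open>y\<^sub>n\<close> lies in \<open>y\<^sub>n\<^sub>+\<^sub>1 (cl V\<^sub>n\<^sub>+\<^sub>1)\<close>, so that \<open>z V\<^sub>0\<close> cannot
  reach back to the neighbourhood of \<open>y\<^sub>n\<close>.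
\<close>

lemma unit_nbhd_inverse:
  assumes U: "openin T U" "\<one> \<in> U"
  obtains V where "openin T V" "\<one> \<in> V" "\<And>v. v \<in> V \<Longrightarrow> inv v \<in> T closure_of U"
proof (rule ccontr)
  assume "\<not> thesis"
  then have neg: "\<exists>v\<in>V. inv v \<notin> T closure_of U" if "openin T V" "\<one> \<in> V" for V
    using that \<open>\<And>V. openin T V \<Longrightarrow> \<one> \<in> V \<Longrightarrow> (\<And>v. v \<in> V \<Longrightarrow> inv v \<in> T closure_of U) \<Longrightarrow> thesis\<close> by blast
  obtain V0 where V0: "openin T V0" "\<one> \<in> V0" "\<And>v w. v \<in> V0 \<Longrightarrow> w \<in> V0 \<Longrightarrow> v \<otimes> w \<in> U"
    using unit_nbhd_square[OF U] by metis
  \<comment> \<open>Halving the neighbourhoods at every stage keeps all products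
    \<open>x (n+1) ... x (n+d)\<close> inside \<open>V n\<close>.\<close>
  have "\<exists>V. \<forall>n. (openin T (V n) \<and> \<one> \<in> V n \<and> V n \<subseteq> V0) \<and> (\<forall>v\<in>V (Suc n). \<forall>w\<in>V (Suc n). v \<otimes> w \<in> V n)"
  proof (rule dependent_nat_choice)
    show "\<exists>V. openin T V \<and> \<one> \<in> V \<and> V \<subseteq> V0" using V0 by blast
  next
    fix V and n :: nat assume V: "openin T V \<and> \<one> \<in> V \<and> V \<subseteq> V0"
    then obtain W where W: "openin T W" "\<one> \<in> W" "\<And>v w. v \<in> W \<Longrightarrow> w \<in> W \<Longrightarrow> v \<otimes> w \<in> V"
      using unit_nbhd_square by metis
    have "W \<subseteq> V" using W open_carrier by (metis r_one subsetI)
    then have "W \<subseteq> V0" using V by blast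
    then show "\<exists>W. (openin T W \<and> \<one> \<in> W \<and> W \<subseteq> V0) \<and> (\<forall>v\<in>W. \<forall>w\<in>W. v \<otimes> w \<in> V)"
      using W by (intro exI[of _ W]) simp
  qed
  then obtain V where V': "\<forall>n. (openin T (V n) \<and> \<one> \<in> V n \<and> V n \<subseteq> V0) \<and>
      (\<forall>v\<in>V (Suc n). \<forall>w\<in>V (Suc n). v \<otimes> w \<in> V n)" ..
  have V: "openin T (V n)" "\<one> \<in> V n" "V n \<subseteq> V0" for n using V' by blast+
  have V_mult: "v \<otimes> w \<in> V n" if "v \<in> V (Suc n)" "w \<in> V (Suc n)" for n v w using V' that by blast
  have "\<forall>n. \<exists>x. x \<in> V n \<and> inv x \<notin> T closure_of U" using neg V(1,2) by blast
  from choice[OF this] obtain x where "\<forall>n. x n \<in> V n \<and> inv (x n) \<notin> T closure_of U" ..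
  then have x: "x n \<in> V n" "inv (x n) \<notin> T closure_of U" for n by simp_all
  have xG [simp]: "x n \<in> carrier G" for n using x(1) V(1) open_carrier by blast
  define y where "y = rec_nat \<one> (\<lambda>n yn. yn \<otimes> x (Suc n))"
  have y_simps: "y 0 = \<one>" "y (Suc n) = y n \<otimes> x (Suc n)" for n by (simp_all add: y_def)
  have yG [simp]: "y n \<in> carrier G" for n by (induction n) (simp_all add: y_simps)
  \<comment> \<open>The element equals \<open>x (n+1) ... x (n+d) q\<close>. The induction absorbs
    its factors from the right, gaining one level of \<open>V\<close> each time.\<close>
  have y_tail: "inv (y n) \<otimes> (y (n + d) \<otimes> q) \<in> V n" if "q \<in> V (n + d)" for n d q
    using that
  proof (induction d arbitrary: q)
    case 0
    then have "q \<in> carrier G" using V(1) open_carrier by blast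
    then show ?case using 0 by simp
  next
    case (Suc d)
    have q: "q \<in> carrier G" using Suc.prems V(1) open_carrier by blast
    have "x (Suc (n + d)) \<otimes> q \<in> V (n + d)" using Suc.prems x(1) V_mult by simp
    from Suc.IH[OF this] show ?case using q by (simp add: y_simps m_assoc)
  qed
  \<comment> \<open>\<open>P n\<close> is a neighbourhood of \<open>\<one>\<close>: since
    \<open>inv (x (Suc n))\<close> avoids the closed set \<open>cl U\<close>, so does
    \<open>inv (x (Suc n)) \<otimes> p\<close> for \<open>p\<close> near \<open>\<one>\<close>. The
    set \<open>Q n\<close> below is the translate of \<open>P n\<close> to
    \<open>y n\<close>.\<close>
  define P where "P n = V (Suc n) \<inter> {p \<in> carrier G. inv (x (Suc n)) \<otimes> p \<in> topspace T - T closure_of U}" for n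
  have P: "openin T (P n)" for n
    unfolding P_def by (intro openin_Int V openin_mult_left_vimage) (auto simp: openin_diff)
  define Q where "Q n = {g \<in> carrier G. inv (y n) \<otimes> g \<in> P n}" for n
  have "openin T (Q n)" for n unfolding Q_def by (intro openin_mult_left_vimage P) auto
  moreover have "y n \<in> Q n" for n
    using V(2) x(2) by (simp add: Q_def P_def topspace_eq)
  ultimately have Q: "openin T (Q n) \<and> Q n \<noteq> {}" for n by blast
  obtain z where zT: "z \<in> topspace T"
    and z: "\<And>W. openin T W \<Longrightarrow> z \<in> W \<Longrightarrow> infinite {n \<in> UNIV. W \<inter> Q n \<noteq> {}}"
    by (rule pseudocompact_space_cluster_point[OF pseudocompact infinite_UNIV_nat, of Q]) (use Q in auto)
  have zG: "z \<in> carrier G" using zT topspace_eq by simp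
  have z_closure: "inv (y n) \<otimes> z \<in> T closure_of (V n)" for n
  proof -
    have "\<exists>c. c \<in> V n \<and> c \<in> W" if W: "inv (y n) \<otimes> z \<in> W" "openin T W" for W
    proof -
      have "openin T {g \<in> carrier G. inv (y n) \<otimes> g \<in> W}" "z \<in> {g \<in> carrier G. inv (y n) \<otimes> g \<in> W}"
        using W zG by (auto intro: openin_mult_left_vimage)
      then have "infinite {k \<in> UNIV. {g \<in> carrier G. inv (y n) \<otimes> g \<in> W} \<inter> Q k \<noteq> {}}" by (rule z)
      then obtain k where k: "n \<le> k" "{g \<in> carrier G. inv (y n) \<otimes> g \<in> W} \<inter> Q k \<noteq> {}"
        unfolding infinite_nat_iff_unbounded_le by blast
      then obtain g where g: "g \<in> carrier G" "inv (y n) \<otimes> g \<in> W" "g \<in> Q k" by blast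
      have q: "inv (y k) \<otimes> g \<in> V (Suc k)" using g(3) by (simp add: Q_def P_def)
      then have "inv (y k) \<otimes> g \<otimes> \<one> \<in> V k" using V(2) by (rule V_mult)
      then have "inv (y k) \<otimes> g \<in> V (n + (k - n))" using k(1) g(1) by simp
      from y_tail[OF this] have "inv (y n) \<otimes> g \<in> V n" using k(1) g(1) by simp
      then show ?thesis using g by auto
    qed
    then show ?thesis using zG by (auto simp: in_closure_of topspace_eq)
  qed
  have "openin T {g \<in> carrier G. inv z \<otimes> g \<in> V0}" "z \<in> {g \<in> carrier G. inv z \<otimes> g \<in> V0}"
    using V0 zG by (auto intro: openin_mult_left_vimage)
  then have "infinite {k \<in> UNIV. {g \<in> carrier G. inv z \<otimes> g \<in> V0} \<inter> Q k \<noteq> {}}" by (rule z)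
  then obtain n where "{g \<in> carrier G. inv z \<otimes> g \<in> V0} \<inter> Q n \<noteq> {}"
    using infinite_imp_nonempty by blast
  then obtain g where g: "g \<in> carrier G" "inv z \<otimes> g \<in> V0" "g \<in> Q n" by blast
  \<comment> \<open>Both factors lie in \<open>cl V0\<close>, so the product is in
    \<open>cl U\<close>; but \<open>z\<close> cancels, leaving exactly the element that
    \<open>g \<in> Q n\<close> keeps out of \<open>cl U\<close>.\<close>
  have "(inv (y (Suc n)) \<otimes> z) \<otimes> (inv z \<otimes> g) \<in> T closure_of U"
  proof (rule closure_mult)
    show "inv (y (Suc n)) \<otimes> z \<in> T closure_of V0"
      using z_closure closure_of_mono[OF V(3)] by blast
    show "inv z \<otimes> g \<in> T closure_of V0"
      using g(2) closure_of_subset[OF openin_subset[OF V0(1)]] by blast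
  qed (rule V0(3))
  also have "(inv (y (Suc n)) \<otimes> z) \<otimes> (inv z \<otimes> g) = inv (x (Suc n)) \<otimes> (inv (y n) \<otimes> g)"
    using zG g(1) by (simp add: m_assoc y_simps inv_mult_group)
  finally show False using g(3) by (simp add: Q_def P_def)
qed

text \<open>Two halvings give \<open>U2\<close> with fourfold products in \<open>U\<close>, and
  inverses of elements of \<open>V\<close> lie in \<open>cl U2\<close>. Hence one quotient lands in
  \<open>cl U1\<close> and a product of two in \<open>cl U\<close>.\<close>

lemma unit_nbhd_quotients:
  assumes U: "openin T U" "\<one> \<in> U"
  obtains V where "openin T V" "\<one> \<in> V"
    "\<And>a b. a \<in> V \<Longrightarrow> b \<in> V \<Longrightarrow> inv a \<otimes> b \<in> T closure_of U"
    "\<And>a b c d. a \<in> V \<Longrightarrow> b \<in> V \<Longrightarrow> c \<in> V \<Longrightarrow> d \<in> V \<Longrightarrow>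
      (a \<otimes> inv b) \<otimes> (c \<otimes> inv d) \<in> T closure_of U"
    "\<And>a b. a \<in> V \<Longrightarrow> b \<in> V \<Longrightarrow> a \<otimes> b \<in> U"
    "V \<subseteq> U"
proof -
  obtain U1 where U1: "openin T U1" "\<one> \<in> U1" "\<And>v w. v \<in> U1 \<Longrightarrow> w \<in> U1 \<Longrightarrow> v \<otimes> w \<in> U"
    using unit_nbhd_square[OF U] by metis
  obtain U2 where U2: "openin T U2" "\<one> \<in> U2" "\<And>v w. v \<in> U2 \<Longrightarrow> w \<in> U2 \<Longrightarrow> v \<otimes> w \<in> U1"
    using unit_nbhd_square[OF U1(1,2)] by metis
  obtain V where V: "openin T V" "\<one> \<in> V" "\<And>v. v \<in> V \<Longrightarrow> inv v \<in> T closure_of U2"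
    using unit_nbhd_inverse[OF U2(1,2)] by metis
  have U2_U1: "U2 \<subseteq> U1" using U2 open_carrier by (metis r_one subsetI)
  have U1_U: "U1 \<subseteq> U" using U1 open_carrier by (metis r_one subsetI)
  let ?V = "V \<inter> U2"
  have inv_cl: "inv v \<in> T closure_of U2" if "v \<in> ?V" for v using V(3) that by blast
  have cl: "v \<in> T closure_of U2" if "v \<in> ?V" for v
    using that closure_of_subset[OF openin_subset[OF U2(1)]] by blast
  have U1_cl: "T closure_of U1 \<subseteq> T closure_of U" using closure_of_mono[OF U1_U] .
  have quot: "a \<otimes> inv b \<in> T closure_of U1" "inv a \<otimes> b \<in> T closure_of U1" if "a \<in> ?V" "b \<in> ?V" for a b
    using that by (auto intro: closure_mult[OF cl inv_cl U2(3)] closure_mult[OF inv_cl cl U2(3)])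
  show thesis
  proof (rule that[of ?V])
    show "openin T ?V" "\<one> \<in> ?V" using V U2 by auto
    show "inv a \<otimes> b \<in> T closure_of U" if "a \<in> ?V" "b \<in> ?V" for a b
      using quot(2)[OF that] U1_cl by blast
    show "(a \<otimes> inv b) \<otimes> (c \<otimes> inv d) \<in> T closure_of U" if "a \<in> ?V" "b \<in> ?V" "c \<in> ?V" "d \<in> ?V" for a b c d
      using closure_mult[OF quot(1)[OF that(1,2)] quot(1)[OF that(3,4)] U1(3)] .
    show "a \<otimes> b \<in> U" if "a \<in> ?V" "b \<in> ?V" for a b using that U2(3) U1_U by blast
    show "?V \<subseteq> U" using U2_U1 U1_U by blast
  qed
qed

theorem sequentially_feebly_compact: "sequentially_feebly_compact T"
proof (rule sequentially_feebly_compactI)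
  fix U :: "nat \<Rightarrow> 'a set" assume U: "\<And>n. openin T (U n)" "\<And>n. U n \<noteq> {}"
  have "\<forall>n. \<exists>x. x \<in> U n" using U(2) by blast
  from choice[OF this] obtain x where "\<forall>n. x n \<in> U n" ..
  then have x: "x n \<in> U n" for n ..
  have xG [simp]: "x n \<in> carrier G" for n using x U(1) open_carrier by blast
  \<comment> \<open>The sets \<open>U n\<close> are moved to the unit, so that one decreasing
    sequence \<open>V\<close> can serve all of them through
    \<open>V n \<subseteq> N n\<close>.\<close>
  define N where "N n = {g \<in> carrier G. x n \<otimes> g \<in> U n}" for n
  have N: "openin T (N n)" "\<one> \<in> N n" for n
    unfolding N_def using x U(1) by (auto intro: openin_mult_left_vimage)
  have "\<exists>V. \<forall>n. (openin T (V n) \<and> \<one> \<in> V n \<and> V n \<subseteq> N n) \<and> (V (Suc n) \<subseteq> V n \<and>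
      (\<forall>a\<in>V (Suc n). \<forall>b\<in>V (Suc n). a \<otimes> b \<in> V n) \<and>
      (\<forall>a\<in>V (Suc n). \<forall>b\<in>V (Suc n). \<forall>c\<in>V (Suc n). \<forall>d\<in>V (Suc n).
        (a \<otimes> inv b) \<otimes> (c \<otimes> inv d) \<in> T closure_of (V n)))"
  proof (rule dependent_nat_choice)
    show "\<exists>V. openin T V \<and> \<one> \<in> V \<and> V \<subseteq> N 0" using N by blast
  next
    fix V n assume V: "openin T V \<and> \<one> \<in> V \<and> V \<subseteq> N n"
    then obtain W where W: "openin T W" "\<one> \<in> W" "\<And>a b. a \<in> W \<Longrightarrow> b \<in> W \<Longrightarrow> a \<otimes> b \<in> V" "W \<subseteq> V"
      "\<And>a b c d. a \<in> W \<Longrightarrow> b \<in> W \<Longrightarrow> c \<in> W \<Longrightarrow> d \<in> W \<Longrightarrow>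
        (a \<otimes> inv b) \<otimes> (c \<otimes> inv d) \<in> T closure_of V"
      using unit_nbhd_quotients[of V] by metis
    show "\<exists>W. (openin T W \<and> \<one> \<in> W \<and> W \<subseteq> N (Suc n)) \<and> (W \<subseteq> V \<and>
        (\<forall>a\<in>W. \<forall>b\<in>W. a \<otimes> b \<in> V) \<and>
        (\<forall>a\<in>W. \<forall>b\<in>W. \<forall>c\<in>W. \<forall>d\<in>W. (a \<otimes> inv b) \<otimes> (c \<otimes> inv d) \<in> T closure_of V))"
      by (rule exI[of _ "W \<inter> N (Suc n)"]) (use W N in auto)
  qed
  then obtain V where V': "\<forall>n. (openin T (V n) \<and> \<one> \<in> V n \<and> V n \<subseteq> N n) \<and> (V (Suc n) \<subseteq> V n \<and>
      (\<forall>a\<in>V (Suc n). \<forall>b\<in>V (Suc n). a \<otimes> b \<in> V n) \<and>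
      (\<forall>a\<in>V (Suc n). \<forall>b\<in>V (Suc n). \<forall>c\<in>V (Suc n). \<forall>d\<in>V (Suc n).
        (a \<otimes> inv b) \<otimes> (c \<otimes> inv d) \<in> T closure_of (V n)))" ..
  have V: "openin T (V n)" "\<one> \<in> V n" "V n \<subseteq> N n" "V (Suc n) \<subseteq> V n" for n using V' by blast+
  have V_mult: "a \<otimes> b \<in> V n" if "a \<in> V (Suc n)" "b \<in> V (Suc n)" for n a b using V' that by blast
  have V_quot: "(a \<otimes> inv b) \<otimes> (c \<otimes> inv d) \<in> T closure_of (V n)"
    if "a \<in> V (Suc n)" "b \<in> V (Suc n)" "c \<in> V (Suc n)" "d \<in> V (Suc n)" for n a b c d
    using V' that by blast
  have V_antimono: "V k \<subseteq> V n" if "n \<le> k" for n k using V(4) that by (rule lift_Suc_antimono_le)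
  have VG: "v \<in> carrier G" if "v \<in> V n" for v n using V(1) that open_carrier by blast
  define A where "A k = {g \<in> carrier G. inv (x k) \<otimes> g \<in> V k}" for k
  have A: "openin T (A k)" "x k \<in> A k" for k
    unfolding A_def using V(1,2) by (auto intro: openin_mult_left_vimage)
  obtain y where yT: "y \<in> topspace T"
    and y: "\<And>W. openin T W \<Longrightarrow> y \<in> W \<Longrightarrow> infinite {n \<in> UNIV. W \<inter> A n \<noteq> {}}"
    by (rule pseudocompact_space_cluster_point[OF pseudocompact infinite_UNIV_nat, of A]) (use A in auto)
  have yG [simp]: "y \<in> carrier G" using yT topspace_eq by simp
  have "infinite {k. {g \<in> carrier G. inv y \<otimes> g \<in> V n} \<inter> A k \<noteq> {}}" for n
    using y[of "{g \<in> carrier G. inv y \<otimes> g \<in> V n}"] V(1,2)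
    by (simp add: openin_mult_left_vimage)
  then obtain r where r: "strict_mono r" "\<And>n. {g \<in> carrier G. inv y \<otimes> g \<in> V n} \<inter> A (r n) \<noteq> {}"
    using infinite_strict_mono_choice[of "\<lambda>n k. {g \<in> carrier G. inv y \<otimes> g \<in> V n} \<inter> A k \<noteq> {}"] by metis
  have r_ge: "n \<le> r n" for n using r(1) by (rule seq_suble)
  \<comment> \<open>A common point \<open>g\<close> of \<open>y V n\<close> and
    \<open>x (r n) V n\<close> expresses \<open>inv y \<otimes> x (r n)\<close> as a
    quotient.\<close>
  have y_x: "\<exists>a\<in>V n. \<exists>b\<in>V n. inv y \<otimes> x (r n) = a \<otimes> inv b" for n
  proof -
    obtain g where g: "g \<in> carrier G" "inv y \<otimes> g \<in> V n" "inv (x (r n)) \<otimes> g \<in> V n"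
      using r(2)[of n] V_antimono[OF r_ge[of n]] by (auto simp: A_def)
    have "inv y \<otimes> x (r n) = (inv y \<otimes> g) \<otimes> inv (inv (x (r n)) \<otimes> g)"
      using g(1) by (simp add: inv_mult_group m_assoc)
    then show ?thesis using g by blast
  qed
  have "\<forall>\<^sub>F n in sequentially. W \<inter> U (r n) \<noteq> {}" if W: "openin T W" "y \<in> W" for W
  proof (rule ccontr)
    define I where "I = {n. W \<inter> U (r n) = {}}"
    assume "\<not> ?thesis"
    then have I: "infinite I"
      unfolding I_def by (simp add: cofinite_eq_sequentially[symmetric] eventually_cofinite)
    define D where "D = {d \<in> carrier G. d \<otimes> y \<in> W}"
    have D: "openin T D" "\<one> \<in> D" unfolding D_def using W by (auto intro: openin_mult_right_vimage)
    obtain E where E: "openin T E" "\<one> \<in> E" "\<And>a b. a \<in> E \<Longrightarrow> b \<in> E \<Longrightarrow> inv a \<otimes> b \<in> T closure_of D"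
      using unit_nbhd_quotients[OF D] by metis
    \<comment> \<open>Two-sided smallness is wanted: the left translate of \<open>V (r n)\<close>
      will place \<open>c\<close> in every \<open>cl (V m)\<close>, and the right translate of
      \<open>E\<close> will place \<open>x (r n) \<otimes> inv y'\<close> in
      \<open>cl D\<close>.\<close>
    define B where "B n = A (r n) \<inter> {g \<in> carrier G. g \<otimes> inv (x (r n)) \<in> E}" for n
    have B: "openin T (B n)" "x (r n) \<in> B n" for n
      unfolding B_def using A E by (auto intro!: openin_Int openin_mult_right_vimage)
    obtain y' where y'T: "y' \<in> topspace T"
      and y': "\<And>W. openin T W \<Longrightarrow> y' \<in> W \<Longrightarrow> infinite {n \<in> I. W \<inter> B n \<noteq> {}}"
      by (rule pseudocompact_space_cluster_point[OF pseudocompact I, of B]) (use B in auto)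
    have y'G [simp]: "y' \<in> carrier G" using y'T topspace_eq by simp
    define c where "c = inv y' \<otimes> y"
    have cG [simp]: "c \<in> carrier G" by (simp add: c_def)
    have c: "c \<in> T closure_of (V m)" for m
    proof -
      have "infinite {n \<in> I. {g \<in> carrier G. inv y' \<otimes> g \<in> V (Suc m)} \<inter> B n \<noteq> {}}"
        by (rule y') (use V(1,2) in \<open>auto intro: openin_mult_left_vimage\<close>)
      then obtain n where n: "Suc m \<le> n" "{g \<in> carrier G. inv y' \<otimes> g \<in> V (Suc m)} \<inter> B n \<noteq> {}"
        unfolding infinite_nat_iff_unbounded_le by blast
      have le: "V (r n) \<subseteq> V (Suc m)" "V n \<subseteq> V (Suc m)"
        using V_antimono n(1) r_ge[of n] by (meson order_trans)+
      obtain g where g: "g \<in> carrier G" "inv y' \<otimes> g \<in> V (Suc m)" "inv (x (r n)) \<otimes> g \<in> V (Suc m)"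
        using n(2) le by (auto simp: A_def B_def)
      obtain a b where ab: "a \<in> V (Suc m)" "b \<in> V (Suc m)" "inv y \<otimes> x (r n) = a \<otimes> inv b"
        using y_x[of n] le by blast
      \<comment> \<open>Passing through \<open>x (r n)\<close> writes \<open>c\<close> as a product
        of two quotients from \<open>V (Suc m)\<close>, the form covered by
        \<open>V_quot\<close>.\<close>
      have "c = (inv y' \<otimes> x (r n)) \<otimes> inv (inv y \<otimes> x (r n))"
        by (simp add: c_def inv_mult_group m_assoc)
      also have "inv y' \<otimes> x (r n) = (inv y' \<otimes> g) \<otimes> inv (inv (x (r n)) \<otimes> g)"
        using g(1) by (simp add: inv_mult_group m_assoc)
      also have "inv (inv y \<otimes> x (r n)) = b \<otimes> inv a"
        unfolding ab(3) using ab(1,2) VG by (simp add: inv_mult_group)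
      finally show ?thesis using V_quot g(2,3) ab(1,2) by simp
    qed
    have "infinite {n \<in> I. {g \<in> carrier G. g \<otimes> inv y' \<in> E} \<inter> B n \<noteq> {}}"
      by (rule y') (use E in \<open>auto intro: openin_mult_right_vimage\<close>)
    then have "{n \<in> I. {g \<in> carrier G. g \<otimes> inv y' \<in> E} \<inter> B n \<noteq> {}} \<noteq> {}"
      by (rule infinite_imp_nonempty)
    then obtain n g where n: "n \<in> I"
      and g: "g \<in> carrier G" "g \<otimes> inv y' \<in> E" "g \<otimes> inv (x (r n)) \<in> E"
      unfolding B_def by blast
    define k where "k = r n"
    txt \<open>The point \<open>x k \<otimes> c\<close> lies in \<open>cl W\<close> and in the interior of \<open>cl (U k)\<close>.\<close>
    have "x k \<otimes> inv y' = inv (g \<otimes> inv (x k)) \<otimes> (g \<otimes> inv y')"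
      using g(1) by (simp add: inv_mult_group m_assoc)
    then have "x k \<otimes> inv y' \<in> T closure_of D" using E(3) g unfolding k_def by simp
    then have "(x k \<otimes> inv y') \<otimes> y \<in> T closure_of W"
      by (rule closure_mult_right[OF yG]) (simp add: D_def)
    then have xc: "x k \<otimes> c \<in> T closure_of W" by (simp add: c_def m_assoc)
    have "openin T {g \<in> carrier G. inv (x k \<otimes> c) \<otimes> g \<in> V (Suc k)}"
      "x k \<otimes> c \<in> {g \<in> carrier G. inv (x k \<otimes> c) \<otimes> g \<in> V (Suc k)}"
      using V(1,2) by (auto intro: openin_mult_left_vimage)
    with xc obtain w where w: "w \<in> W" "w \<in> carrier G" "inv (x k \<otimes> c) \<otimes> w \<in> V (Suc k)"
      unfolding in_closure_of by (metis (no_types, lifting) mem_Collect_eq)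
    have "inv (x k \<otimes> c) \<otimes> w \<in> T closure_of (V (Suc k))"
      using w(3) closure_of_subset[OF openin_subset[OF V(1)]] by blast
    \<comment> \<open>With \<open>w = x k \<otimes> c \<otimes> v\<close>, both \<open>c\<close> and
      \<open>v\<close> lie in \<open>cl (V (Suc k))\<close>. Thus \<open>c \<otimes> v\<close> is in
      \<open>cl (V k)\<close> and \<open>w\<close> in \<open>cl (U k)\<close>, so the open set
      \<open>W\<close> around \<open>w\<close> meets \<open>U k\<close>.\<close>
    from closure_mult[OF c this V_mult]
    have "c \<otimes> (inv (x k \<otimes> c) \<otimes> w) \<in> T closure_of (V k)" .
    then have "x k \<otimes> (c \<otimes> (inv (x k \<otimes> c) \<otimes> w)) \<in> T closure_of (U k)"
      by (rule closure_mult_left[OF xG]) (use V(3) in \<open>auto simp: N_def\<close>)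
    also have "x k \<otimes> (c \<otimes> (inv (x k \<otimes> c) \<otimes> w)) = w"
      using w(2) by (simp add: m_assoc[symmetric])
    finally have "W \<inter> U k \<noteq> {}" using W(1) w(1) unfolding in_closure_of by blast
    then show False using n unfolding I_def k_def by simp
  qed
  then have "set_limit T (U \<circ> r) y" using yT unfolding set_limit_def by simp
  then show "\<exists>x r. strict_mono r \<and> set_limit T (U \<circ> r) x" using r(1) by blast
qed

end

lemma pseudocompact_paratopological_group_imp_sequentially_feebly_compact:
  assumes "paratopological_group X m" "pseudocompact_space X"
  shows "sequentially_feebly_compact X"
proof -
  have sg: "semigroup_on (topspace X) m" and sub: "subgroup_of (topspace X) m (topspace X)"
    and cont: "continuous_map (prod_topology X X) X (\<lambda>(x, y). m x y)"
    using assms(1) unfolding paratopological_group_def by auto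
  obtain e where e: "e \<in> topspace X" "\<And>x. x \<in> topspace X \<Longrightarrow> m e x = x"
    "\<And>x. x \<in> topspace X \<Longrightarrow> \<exists>y\<in>topspace X. m y x = e"
    using sub unfolding subgroup_of_def by metis
  let ?G = "\<lparr>carrier = topspace X, mult = m, one = e\<rparr>"
  have "group ?G"
    by (rule groupI) (use sg e in \<open>auto simp: semigroup_on_def\<close>)
  then interpret pseudocompact_paratopological_group ?G X
    by (intro pseudocompact_paratopological_group.intro paratopological_group_structure.intro
        paratopological_group_structure_axioms.intro pseudocompact_paratopological_group_axioms.intro)
       (use cont assms(2) in simp_all)
  show ?thesis by (rule sequentially_feebly_compact)
qed

section \<open>Primitive inverse semigroups\<close>

locale primitive_inverse =
  fixes S :: "'a set" and m :: "'a \<Rightarrow> 'a \<Rightarrow> 'a" (infixl "\<cdot>" 70)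
  assumes primitive: "primitive_inverse_semigroup S m"
begin

text \<open>The choice is made from the whole conjunction, so that the chosen zero is the one for
  which minimality of idempotents is asserted.\<close>

definition zero :: 'a where "zero = (SOME z. is_zero S m z \<and>
   (\<forall>e f. idempotent_in S m e \<and> idempotent_in S m f \<and> e \<noteq> z \<and> f \<noteq> z \<and>
          f = m e f \<and> f = m f e \<longrightarrow> f = e))"

definition inverse :: "'a \<Rightarrow> 'a" where
  "inverse x = (THE y. y \<in> S \<and> x \<cdot> y \<cdot> x = x \<and> y \<cdot> x \<cdot> y = y)"

lemma closed [simp]: "x \<in> S \<Longrightarrow> y \<in> S \<Longrightarrow> x \<cdot> y \<in> S"
  and assoc: "x \<in> S \<Longrightarrow> y \<in> S \<Longrightarrow> z \<in> S \<Longrightarrow> x \<cdot> y \<cdot> z = x \<cdot> (y \<cdot> z)"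
  using primitive unfolding primitive_inverse_semigroup_def inverse_semigroup_def semigroup_on_def by auto

lemma ex1_inverse: "x \<in> S \<Longrightarrow> \<exists>!y. y \<in> S \<and> x \<cdot> y \<cdot> x = x \<and> y \<cdot> x \<cdot> y = y"
  using primitive unfolding primitive_inverse_semigroup_def inverse_semigroup_def by auto

lemma inverse_closed [simp]: "x \<in> S \<Longrightarrow> inverse x \<in> S"
  and mult_inverse_mult: "x \<in> S \<Longrightarrow> x \<cdot> inverse x \<cdot> x = x"
  and inverse_mult_inverse: "x \<in> S \<Longrightarrow> inverse x \<cdot> x \<cdot> inverse x = inverse x"
  using theI'[OF ex1_inverse] unfolding inverse_def by blast+

lemma inverse_unique:
  "x \<in> S \<Longrightarrow> y \<in> S \<Longrightarrow> x \<cdot> y \<cdot> x = x \<Longrightarrow> y \<cdot> x \<cdot> y = y \<Longrightarrow> y = inverse x"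
  unfolding inverse_def by (rule sym, rule the1_equality[OF ex1_inverse]) auto

lemma zero_props: "is_zero S m zero"
    "\<And>e f. idempotent_in S m e \<Longrightarrow> idempotent_in S m f \<Longrightarrow> e \<noteq> zero \<Longrightarrow> f \<noteq> zero \<Longrightarrow>
       e \<cdot> f = f \<Longrightarrow> f \<cdot> e = f \<Longrightarrow> f = e"
proof -
  have "is_zero S m zero \<and>
   (\<forall>e f. idempotent_in S m e \<and> idempotent_in S m f \<and> e \<noteq> zero \<and> f \<noteq> zero \<and>
          f = m e f \<and> f = m f e \<longrightarrow> f = e)"
    unfolding zero_def
    by (rule someI_ex) (use primitive in \<open>simp add: primitive_inverse_semigroup_def\<close>)
  then show "is_zero S m zero"
    "\<And>e f. idempotent_in S m e \<Longrightarrow> idempotent_in S m f \<Longrightarrow> e \<noteq> zero \<Longrightarrow> f \<noteq> zero \<Longrightarrow>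
       e \<cdot> f = f \<Longrightarrow> f \<cdot> e = f \<Longrightarrow> f = e" by metis+
qed

lemma zero_closed [simp]: "zero \<in> S"
  and zero_left [simp]: "x \<in> S \<Longrightarrow> zero \<cdot> x = zero"
  and zero_right [simp]: "x \<in> S \<Longrightarrow> x \<cdot> zero = zero"
  using zero_props(1) unfolding is_zero_def by auto

text \<open>For \<open>g\<close> the inverse of \<open>e \<cdot> f\<close>, the element
  \<open>f \<cdot> g \<cdot> e\<close> is an inverse too, so it equals \<open>g\<close>. This makes
  \<open>g\<close> idempotent, hence its own inverse, and therefore
  \<open>e \<cdot> f = g\<close>.\<close>

lemma idempotent_mult:
  assumes e: "e \<in> S" "e \<cdot> e = e" and f: "f \<in> S" "f \<cdot> f = f"
  shows "(e \<cdot> f) \<cdot> (e \<cdot> f) = e \<cdot> f"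
proof -
  have ee: "e \<cdot> (e \<cdot> x) = e \<cdot> x" if "x \<in> S" for x using assoc[of e e x] e that by simp
  have ff: "f \<cdot> (f \<cdot> x) = f \<cdot> x" if "x \<in> S" for x using assoc[of f f x] f that by simp
  define g where "g = inverse (e \<cdot> f)"
  have g: "g \<in> S" using e f by (simp add: g_def)
  have 1: "e \<cdot> (f \<cdot> (g \<cdot> (e \<cdot> f))) = e \<cdot> f" and 2: "g \<cdot> (e \<cdot> (f \<cdot> g)) = g"
    using mult_inverse_mult[of "e \<cdot> f"] inverse_mult_inverse[of "e \<cdot> f"] e f g
    unfolding g_def[symmetric] by (simp_all add: assoc)
  have absorb: "g \<cdot> (e \<cdot> (f \<cdot> (g \<cdot> x))) = g \<cdot> x" if "x \<in> S" for x
    using arg_cong[OF 2, of "\<lambda>y. y \<cdot> x"] e f g that by (simp add: assoc)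
  have "f \<cdot> g \<cdot> e = inverse (e \<cdot> f)"
    by (rule inverse_unique) (use e f g 1 absorb ee ff in \<open>simp_all add: assoc\<close>)
  then have fge: "f \<cdot> (g \<cdot> e) = g" using e f g by (simp add: g_def assoc)
  have gg: "g \<cdot> g = g"
  proof -
    have "g \<cdot> g = (f \<cdot> (g \<cdot> e)) \<cdot> (f \<cdot> (g \<cdot> e))" by (simp add: fge)
    also have "\<dots> = f \<cdot> (g \<cdot> (e \<cdot> (f \<cdot> (g \<cdot> e))))" using e f g by (simp add: assoc)
    also have "\<dots> = f \<cdot> (g \<cdot> e)" using e f g by (simp add: absorb)
    also have "\<dots> = g" by (rule fge)
    finally show ?thesis .
  qed
  have "g = inverse g" by (rule inverse_unique) (use g gg in simp_all)
  moreover have "e \<cdot> f = inverse g"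
    by (rule inverse_unique) (use e f g 1 2 in \<open>simp_all add: assoc\<close>)
  ultimately show ?thesis using gg by simp
qed

text \<open>As products of idempotents are idempotent, \<open>e \<cdot> f\<close> and
  \<open>f \<cdot> e\<close> are both inverses of \<open>e \<cdot> f\<close>.\<close>

lemma idempotents_commute:
  assumes e: "e \<in> S" "e \<cdot> e = e" and f: "f \<in> S" "f \<cdot> f = f"
  shows "e \<cdot> f = f \<cdot> e"
proof -
  have ee: "e \<cdot> (e \<cdot> x) = e \<cdot> x" if "x \<in> S" for x using assoc[of e e x] e that by simp
  have ff: "f \<cdot> (f \<cdot> x) = f \<cdot> x" if "x \<in> S" for x using assoc[of f f x] f that by simp
  have ef: "e \<cdot> (f \<cdot> (e \<cdot> f)) = e \<cdot> f" using idempotent_mult[OF e f] e f by (simp add: assoc)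
  have fe: "f \<cdot> (e \<cdot> (f \<cdot> e)) = f \<cdot> e" using idempotent_mult[OF f e] e f by (simp add: assoc)
  have "f \<cdot> e = inverse (e \<cdot> f)"
    by (rule inverse_unique) (use e f ef fe ee ff in \<open>simp_all add: assoc\<close>)
  moreover have "e \<cdot> f = inverse (e \<cdot> f)"
    by (rule inverse_unique) (use e f ef ee ff in \<open>simp_all add: assoc\<close>)
  ultimately show ?thesis by simp
qed

text \<open>The non-zero idempotent \<open>e \<cdot> f\<close> lies below both \<open>e\<close> and
  \<open>f\<close>, so minimality identifies it with each of them.\<close>

lemma primitive_eq:
  assumes e: "e \<in> S" "e \<cdot> e = e" and f: "f \<in> S" "f \<cdot> f = f" and ef: "e \<cdot> f \<noteq> zero"
  shows "e = f"
proof -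
  have comm: "f \<cdot> e = e \<cdot> f" using idempotents_commute[OF e f] by simp
  have ee: "e \<cdot> (e \<cdot> x) = e \<cdot> x" if "x \<in> S" for x using assoc[of e e x] e that by simp
  have idem: "idempotent_in S m e" "idempotent_in S m f" "idempotent_in S m (e \<cdot> f)"
    unfolding idempotent_in_def using e f idempotent_mult[OF e f] by auto
  have nz: "e \<noteq> zero" "f \<noteq> zero" using ef e f by auto
  have "e \<cdot> f = e"
  proof (rule zero_props(2)[OF idem(1,3) nz(1) ef])
    show "e \<cdot> (e \<cdot> f) = e \<cdot> f" using e f by (simp add: ee)
    show "e \<cdot> f \<cdot> e = e \<cdot> f" using e f comm by (simp add: assoc ee)
  qed
  moreover have "e \<cdot> f = f"
  proof (rule zero_props(2)[OF idem(2,3) nz(2) ef])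
    show "e \<cdot> f \<cdot> f = e \<cdot> f" using e f by (simp add: assoc)
    show "f \<cdot> (e \<cdot> f) = e \<cdot> f" using e f comm assoc[of f e f] assoc[of e f f] by simp
  qed
  ultimately show ?thesis by simp
qed

text \<open>For non-zero idempotents \<open>e\<close> and \<open>f\<close> this is the intersection
  of the R-class of \<open>e\<close> with the L-class of \<open>f\<close> (Green's relations). The
  form chosen makes it the preimage of the non-zero elements under two translations, hence
  open.\<close>

definition H :: "'a \<Rightarrow> 'a \<Rightarrow> 'a set" where "H e f = {x \<in> S. e \<cdot> x \<cdot> f \<noteq> zero}"

lemma domain_range_idempotent:
  assumes "x \<in> S"
  shows "x \<cdot> inverse x \<in> S" "(x \<cdot> inverse x) \<cdot> (x \<cdot> inverse x) = x \<cdot> inverse x"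
    "inverse x \<cdot> x \<in> S" "(inverse x \<cdot> x) \<cdot> (inverse x \<cdot> x) = inverse x \<cdot> x"
  using assms mult_inverse_mult[OF assms] inverse_mult_inverse[OF assms] by (simp_all flip: assoc)

text \<open>If \<open>e \<cdot> x \<cdot> f\<close> is non-zero, then so are
  \<open>e \<cdot> (x \<cdot> inverse x)\<close> and \<open>inverse x \<cdot> x \<cdot> f\<close>,
  and \<open>primitive_eq\<close> applies to both.\<close>

lemma H_iff:
  assumes e: "e \<in> S" "e \<cdot> e = e" and f: "f \<in> S" "f \<cdot> f = f"
  shows "x \<in> H e f \<longleftrightarrow> x \<in> S \<and> x \<noteq> zero \<and> x \<cdot> inverse x = e \<and> inverse x \<cdot> x = f"
proof
  assume "x \<in> H e f"
  then have x: "x \<in> S" "e \<cdot> x \<cdot> f \<noteq> zero" unfolding H_def by auto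
  have xx: "x \<cdot> (inverse x \<cdot> x) = x" using mult_inverse_mult[OF x(1)] x(1) by (simp add: assoc)
  have ex: "e \<cdot> x \<noteq> zero" "x \<noteq> zero" using x e f by auto
  have xf: "x \<cdot> f \<noteq> zero" using x e f assoc[of e x f] by auto
  have "e \<cdot> (x \<cdot> inverse x) \<cdot> x = e \<cdot> x" using x(1) e(1) xx by (simp add: assoc)
  then have "e \<cdot> (x \<cdot> inverse x) \<noteq> zero" using ex x(1) by auto
  then have "e = x \<cdot> inverse x" using primitive_eq e domain_range_idempotent[OF x(1)] by blast
  moreover have "x \<cdot> (inverse x \<cdot> x \<cdot> f) = x \<cdot> f"
    using assoc[of x "inverse x \<cdot> x" f] x(1) f(1) xx by simp
  then have "inverse x \<cdot> x \<cdot> f \<noteq> zero" using xf x(1) by auto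
  then have "inverse x \<cdot> x = f" using primitive_eq f domain_range_idempotent[OF x(1)] by blast
  ultimately show "x \<in> S \<and> x \<noteq> zero \<and> x \<cdot> inverse x = e \<and> inverse x \<cdot> x = f" using x ex by simp
next
  assume "x \<in> S \<and> x \<noteq> zero \<and> x \<cdot> inverse x = e \<and> inverse x \<cdot> x = f"
  then show "x \<in> H e f" unfolding H_def using mult_inverse_mult[of x] assoc[of x "inverse x" x] by auto
qed

lemma H_units:
  assumes e: "e \<in> S" "e \<cdot> e = e" and f: "f \<in> S" "f \<cdot> f = f" and x: "x \<in> H e f"
  shows "e \<cdot> x = x" "x \<cdot> f = x"
  using H_iff[OF e f, of x] x mult_inverse_mult[of x] assoc[of x "inverse x" x] by auto

text \<open>The product cannot vanish, because multiplying it by \<open>inverse y\<close> gives back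
  \<open>x \<cdot> f = x\<close>.\<close>

lemma H_mult:
  assumes e: "e \<in> S" "e \<cdot> e = e" and f: "f \<in> S" "f \<cdot> f = f" and g: "g \<in> S" "g \<cdot> g = g"
    and x: "x \<in> H e f" and y: "y \<in> H f g"
  shows "x \<cdot> y \<in> H e g"
proof -
  have xy: "x \<in> S" "y \<in> S" "x \<noteq> zero" using x y H_iff[OF e f] H_iff[OF f g] by auto
  have "x \<cdot> y \<cdot> inverse y = x \<cdot> (y \<cdot> inverse y)" using xy by (simp add: assoc)
  also have "\<dots> = x" using H_iff[OF f g, of y] y H_units(2)[OF e f x] by simp
  finally have "x \<cdot> y \<noteq> zero" using xy by auto
  moreover have "e \<cdot> (x \<cdot> y) \<cdot> g = x \<cdot> y"
    using H_units[OF e f x] H_units[OF f g y] e g xy assoc[of e x y] assoc[of x y g] by simp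
  ultimately show ?thesis using xy unfolding H_def by simp
qed

lemma H_inverse:
  assumes e: "e \<in> S" "e \<cdot> e = e" and f: "f \<in> S" "f \<cdot> f = f" and x: "x \<in> H e f"
  shows "inverse x \<in> H f e"
proof -
  have xS: "x \<in> S" "x \<noteq> zero" using x H_iff[OF e f] by auto
  have ii: "x = inverse (inverse x)"
    by (rule inverse_unique) (use xS in \<open>simp_all add: mult_inverse_mult inverse_mult_inverse\<close>)
  have "inverse x \<noteq> zero" using xS mult_inverse_mult[of x] by auto
  then show ?thesis using ii xS x H_iff[OF e f, of x] H_iff[OF f e, of "inverse x"] by simp
qed

lemma H_self: "e \<in> S \<Longrightarrow> e \<cdot> e = e \<Longrightarrow> e \<noteq> zero \<Longrightarrow> e \<in> H e e"
  unfolding H_def by simp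

text \<open>In a larger subgroup \<open>K\<close> the idempotent \<open>e\<close> must be the
  identity. Each \<open>x\<close> in \<open>K\<close> then divides \<open>e\<close>, so it is
  non-zero, and \<open>e \<cdot> x \<cdot> e = x\<close> puts it into \<open>H e e\<close>.\<close>

lemma maximal_subgroup_H:
  assumes e: "e \<in> S" "e \<cdot> e = e" "e \<noteq> zero"
  shows "maximal_subgroup S m (H e e)"
  unfolding maximal_subgroup_def
proof (intro conjI allI impI)
  note ee = e(1,2) e(1,2)
  have eH: "e \<in> H e e" using e by (rule H_self)
  have "\<exists>y\<in>H e e. x \<cdot> y = e \<and> y \<cdot> x = e" if "x \<in> H e e" for x
    using H_inverse[OF ee that] that H_iff[OF ee, of x] by auto
  moreover have "H e e \<subseteq> S" unfolding H_def by blast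
  moreover have "\<forall>x\<in>H e e. \<forall>y\<in>H e e. x \<cdot> y \<in> H e e" using H_mult[OF ee e(1,2)] by blast
  moreover have "\<forall>x\<in>H e e. e \<cdot> x = x \<and> x \<cdot> e = x" using H_units[OF ee] by blast
  ultimately show "subgroup_of S m (H e e)" unfolding subgroup_of_def using eH by blast
  fix K assume K: "subgroup_of S m K \<and> H e e \<subseteq> K"
  then obtain k where k: "k \<in> K" "\<And>x. x \<in> K \<Longrightarrow> k \<cdot> x = x \<and> x \<cdot> k = x"
    "\<And>x. x \<in> K \<Longrightarrow> \<exists>y\<in>K. x \<cdot> y = k \<and> y \<cdot> x = k" and KS: "K \<subseteq> S"
    unfolding subgroup_of_def by metis
  have eK: "e \<in> K" using K eH by blast
  obtain y where y: "y \<in> K" "e \<cdot> y = k" using k(3)[OF eK] by blast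
  have "k = e \<cdot> (e \<cdot> y)" using y KS e assoc[of e e y] by auto
  also have "\<dots> = e" using y k(2)[OF eK] by simp
  finally have ke: "k = e" .
  have "x \<in> H e e" if x: "x \<in> K" for x
  proof -
    obtain y where y: "y \<in> K" "x \<cdot> y = e" using k(3)[OF x] ke by blast
    then have "x \<noteq> zero" using e KS by auto
    then show ?thesis unfolding H_def using k(2)[OF x] KS x ke by auto
  qed
  then show "K = H e e" using K by blast
qed

text \<open>Right multiplication by \<open>inverse a\<close> leads back from \<open>H e f\<close> to
  \<open>H e e\<close>.\<close>

lemma H_translate:
  assumes e: "e \<in> S" "e \<cdot> e = e" and f: "f \<in> S" "f \<cdot> f = f" and a: "a \<in> H e f"
  shows "(\<lambda>x. x \<cdot> a) ` H e e = H e f"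
proof (intro equalityI subsetI)
  fix x assume "x \<in> (\<lambda>x. x \<cdot> a) ` H e e"
  then show "x \<in> H e f" using H_mult[OF e e f _ a] by blast
next
  fix x assume x: "x \<in> H e f"
  have xa: "x \<cdot> inverse a \<in> H e e" using H_mult[OF e f e x H_inverse[OF e f a]] .
  have S: "x \<in> S" "a \<in> S" using x a unfolding H_def by auto
  have "x \<cdot> inverse a \<cdot> a = x \<cdot> (inverse a \<cdot> a)" using S by (simp add: assoc)
  also have "\<dots> = x" using H_iff[OF e f, of a] a H_units(2)[OF e f x] by simp
  finally show "x \<in> (\<lambda>x. x \<cdot> a) ` H e e" using xa by force
qed

lemma nonzero_in_H:
  assumes "x \<in> S" "x \<noteq> zero"
  shows "x \<in> H (x \<cdot> inverse x) (inverse x \<cdot> x)"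
  using H_iff[OF domain_range_idempotent[OF assms(1)]] assms by simp

end

section \<open>From maximal subgroups to the whole semigroup\<close>

lemma sequentially_feebly_compact_primitive_inverse_semigroup:
  assumes semitop: "semitopological_semigroup X m"
    and prim: "primitive_inverse_semigroup (topspace X) m"
    and psc: "pseudocompact_space X"
    and subgroups: "\<And>H. maximal_subgroup (topspace X) m H \<Longrightarrow> sequentially_feebly_compact (subtopology X H)"
  shows "sequentially_feebly_compact X"
proof -
  interpret primitive_inverse "topspace X" m by standard (rule prim)
  let ?S = "topspace X"
  have left: "continuous_map X X (\<lambda>x. m a x)" and right: "continuous_map X X (\<lambda>x. m x a)"
    if "a \<in> ?S" for a using semitop that unfolding semitopological_semigroup_def by auto
  have "closedin X {zero}"
    using semitop by (simp add: semitopological_semigroup_def closedin_Hausdorff_singleton)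
  then have nonzero: "openin X (?S - {zero})" by (simp add: openin_diff)
  have open_H: "openin X (H e f)" if "e \<in> ?S" "f \<in> ?S" for e f
  proof -
    have "continuous_map X X (\<lambda>x. m (m e x) f)"
      using continuous_map_compose[OF left[OF that(1)] right[OF that(2)]] by (simp add: comp_def)
    from openin_continuous_map_preimage[OF this nonzero]
    show ?thesis unfolding H_def using that by (auto elim!: back_subst[of "openin X"])
  qed
  \<comment> \<open>Indexing by non-zero elements supplies each member of the cover with an element
    \<open>a\<close>, along which the maximal subgroup \<open>H e e\<close> is translated onto
    it.\<close>
  define \<C> where "\<C> = (\<lambda>x. H (m x (inverse x)) (m (inverse x) x)) ` (?S - {zero})"
  show ?thesis
  proof (rule sequentially_feebly_compact_point_open_cover[OF psc zero_closed, of \<C>])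
    show "?S - {zero} \<subseteq> \<Union>\<C>" unfolding \<C>_def using nonzero_in_H by blast
  next
    fix C assume "C \<in> \<C>"
    then obtain a where a: "a \<in> ?S" "a \<noteq> zero" and C: "C = H (m a (inverse a)) (m (inverse a) a)"
      unfolding \<C>_def by blast
    define e f where "e = m a (inverse a)" and "f = m (inverse a) a"
    have e: "e \<in> ?S" "m e e = e" and f: "f \<in> ?S" "m f f = f"
      using domain_range_idempotent[OF a(1)] unfolding e_def f_def by auto
    have aH: "a \<in> H e f" using nonzero_in_H[OF a] unfolding e_def f_def .
    have C: "C = H e f" using C unfolding e_def f_def .
    show "openin X C" unfolding C using e f by (intro open_H)
    have "e \<noteq> zero" using H_units(1)[OF e f aH] a by auto
    then have sfc: "sequentially_feebly_compact (subtopology X (H e e))"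
      using maximal_subgroup_H[OF e] subgroups by blast
    have sub: "H e e \<subseteq> ?S" "H e f \<subseteq> ?S" unfolding H_def by auto
    show "sequentially_feebly_compact (subtopology X C)" unfolding C
    proof (rule sequentially_feebly_compact_continuous_map_image[OF sfc])
      have image: "(\<lambda>x. m x a) ` H e e = H e f" using H_translate[OF e f aH] .
      have "continuous_map (subtopology X (H e e)) X (\<lambda>x. m x a)"
        using right[OF a(1)] by (rule continuous_map_from_subtopology)
      then show "continuous_map (subtopology X (H e e)) (subtopology X (H e f)) (\<lambda>x. m x a)"
        unfolding continuous_map_in_subtopology using image by auto
      show "(\<lambda>x. m x a) ` topspace (subtopology X (H e e)) = topspace (subtopology X (H e f))"
        using image sub by (simp add: Int_absorb1)
    qed
  qed
qed

section \<open>The direct product\<close>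

lemma semitopological_semigroup_product:
  assumes "\<And>j. j \<in> J \<Longrightarrow> semitopological_semigroup (X j) (m j)"
  shows "semitopological_semigroup (product_topology X J) (prod_mult J m)"
proof -
  let ?P = "product_topology X J"
  have sg: "semigroup_on (topspace (X j)) (m j)" "Hausdorff_space (X j)"
    and cont: "\<And>a. a \<in> topspace (X j) \<Longrightarrow> continuous_map (X j) (X j) (m j a)"
      "\<And>a. a \<in> topspace (X j) \<Longrightarrow> continuous_map (X j) (X j) (\<lambda>x. m j x a)" if "j \<in> J" for j
    using assms[OF that] unfolding semitopological_semigroup_def by auto
  have "Hausdorff_space ?P" using sg(2) by (simp add: Hausdorff_space_product_topology)
  moreover have "semigroup_on (topspace ?P) (prod_mult J m)"
    using sg(1) unfolding semigroup_on_def prod_mult_def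
    by (auto simp: PiE_iff intro!: restrict_ext)
  moreover have "continuous_map ?P ?P (\<lambda>x. prod_mult J m a x) \<and> continuous_map ?P ?P (\<lambda>x. prod_mult J m x a)"
    if a: "a \<in> topspace ?P" for a
  proof -
    have aj: "a j \<in> topspace (X j)" if "j \<in> J" for j using a that by (auto simp: PiE_iff)
    have "continuous_map ?P (X j) (\<lambda>x. m j (a j) (x j)) \<and> continuous_map ?P (X j) (\<lambda>x. m j (x j) (a j))"
      if j: "j \<in> J" for j
      using continuous_map_compose[OF continuous_map_product_projection[OF j, of X] cont(1)[OF j aj[OF j]]]
        continuous_map_compose[OF continuous_map_product_projection[OF j, of X] cont(2)[OF j aj[OF j]]]
      by (simp add: comp_def)
    then show ?thesis
      by (auto simp: continuous_map_componentwise prod_mult_def)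
  qed
  ultimately show ?thesis unfolding semitopological_semigroup_def by blast
qed

text \<open>The inverse equations split into coordinates, so the function of coordinatewise inverses
  solves them; extensionality fixes its values outside \<open>J\<close> and gives
  uniqueness.\<close>

lemma inverse_semigroup_PiE:
  assumes "\<And>j. j \<in> J \<Longrightarrow> inverse_semigroup (S j) (m j)"
  shows "inverse_semigroup (Pi\<^sub>E J S) (prod_mult J m)"
proof -
  have closed: "m j x y \<in> S j" and assoc: "z \<in> S j \<Longrightarrow> m j (m j x y) z = m j x (m j y z)"
    if "j \<in> J" "x \<in> S j" "y \<in> S j" for j x y z
    using assms[OF that(1)] that unfolding inverse_semigroup_def semigroup_on_def by auto
  have ex1: "\<exists>!y. y \<in> S j \<and> m j (m j x y) x = x \<and> m j (m j y x) y = y" if "j \<in> J" "x \<in> S j" for j x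
    using assms[OF that(1)] that unfolding inverse_semigroup_def by auto
  have "semigroup_on (Pi\<^sub>E J S) (prod_mult J m)"
    unfolding semigroup_on_def prod_mult_def
    by (auto simp: PiE_iff closed assoc intro!: restrict_ext)
  moreover have "\<exists>!y. y \<in> Pi\<^sub>E J S \<and> prod_mult J m (prod_mult J m x y) x = x \<and>
      prod_mult J m (prod_mult J m y x) y = y" if x: "x \<in> Pi\<^sub>E J S" for x
  proof -
    have xj: "x j \<in> S j" if "j \<in> J" for j using x that by blast
    have iff: "y \<in> Pi\<^sub>E J S \<and> prod_mult J m (prod_mult J m x y) x = x \<and> prod_mult J m (prod_mult J m y x) y = y
      \<longleftrightarrow> y \<in> extensional J \<and> (\<forall>j\<in>J. y j \<in> S j \<and> m j (m j (x j) (y j)) (x j) = x j \<and> m j (m j (y j) (x j)) (y j) = y j)" for y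
      using x unfolding prod_mult_def
      by (auto simp: PiE_iff fun_eq_iff restrict_def extensional_def)
    define z where "z = (\<lambda>j\<in>J. THE y. y \<in> S j \<and> m j (m j (x j) y) (x j) = x j \<and> m j (m j y (x j)) y = y)"
    show ?thesis unfolding iff
    proof (rule ex1I[of _ z])
      show "z \<in> extensional J \<and> (\<forall>j\<in>J. z j \<in> S j \<and> m j (m j (x j) (z j)) (x j) = x j \<and> m j (m j (z j) (x j)) (z j) = z j)"
        using theI'[OF ex1[OF _ xj]] by (simp add: z_def)
      fix y assume y: "y \<in> extensional J \<and> (\<forall>j\<in>J. y j \<in> S j \<and> m j (m j (x j) (y j)) (x j) = x j \<and> m j (m j (y j) (x j)) (y j) = y j)"
      show "y = z"
      proof (rule extensionalityI[of _ J])
        fix j assume j: "j \<in> J"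
        show "y j = z j" using the1_equality[OF ex1[OF j xj[OF j]], of "y j"] y j by (simp add: z_def)
      qed (use y in \<open>auto simp: z_def\<close>)
    qed
  qed
  ultimately show ?thesis unfolding inverse_semigroup_def by blast
qed

theorem theorem2p19:
  fixes J :: "'j set" and X :: "'j \<Rightarrow> 'a topology" and m :: "'j \<Rightarrow> 'a \<Rightarrow> 'a \<Rightarrow> 'a"
  assumes "J \<noteq> {}"
    and "\<And>j. j \<in> J \<Longrightarrow> semitopological_semigroup (X j) (m j)"
    and "\<And>j. j \<in> J \<Longrightarrow> primitive_inverse_semigroup (topspace (X j)) (m j)"
    and "\<And>j. j \<in> J \<Longrightarrow>
           (semiregular_space (X j) \<and> pseudocompact_space (X j)) \<or> countably_compact_space (X j)"
    and "\<And>j H. j \<in> J \<Longrightarrow> maximal_subgroup (topspace (X j)) (m j) H \<Longrightarrow>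
           paratopological_group (subtopology (X j) H) (m j) \<and>
           pseudocompact_space (subtopology (X j) H)"
  shows "semitopological_semigroup (product_topology X J) (prod_mult J m) \<and>
         inverse_semigroup (topspace (product_topology X J)) (prod_mult J m) \<and>
         pseudocompact_space (product_topology X J)"
proof -
  have "sequentially_feebly_compact (X j)" if j: "j \<in> J" for j
  proof (rule sequentially_feebly_compact_primitive_inverse_semigroup[OF assms(2,3)[OF j]])
    show "pseudocompact_space (X j)"
      using assms(4)[OF j] countably_compact_imp_pseudocompact by blast
    show "sequentially_feebly_compact (subtopology (X j) H)"
      if "maximal_subgroup (topspace (X j)) (m j) H" for H
      using assms(5)[OF j that] pseudocompact_paratopological_group_imp_sequentially_feebly_compact
      by blast
  qed
  then have "pseudocompact_space (product_topology X J)"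
    by (intro sequentially_feebly_compact_imp_pseudocompact sequentially_feebly_compact_product)
  moreover have "inverse_semigroup (topspace (product_topology X J)) (prod_mult J m)"
    using assms(3) unfolding topspace_product_topology primitive_inverse_semigroup_def comp_def
    by (intro inverse_semigroup_PiE) blast
  ultimately show ?thesis
    using semitopological_semigroup_product assms(2) by blast
qed

end
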